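(* Let $\mathsf{GR}=\mathsf{GR}(p^e,d)$, $A\in\mathsf{GR}^{t\times r}$, $B\in\mathsf{GR}^{r\times s}$, let $N$ be the number of worker nodes, $m=\lceil\log_p(N)/d\rceil$ (with $\sqrt m$ an integer), and let $n=\Theta(\sqrt m)$ be a common divisor of $s$ and $t$. Let $u\mid\frac tn$, $v\mid\frac sn$, $w\mid r$ be divisors such that $R:=uvw+w-1\le N$. Then the scheme $\widetilde{\mathsf{EP}}_{\mathsf{RMFE}}$-II (defined in the context) computes $AB$ with recovery threshold $R$. Moreover, its communication complexities, counted in elements of $\mathsf{GR}$, are - upload: $O\left(\frac{trv+sru}{uvw}\,\sqrt m\,N\right)$; - download: $O\left(\frac{ts}{uv}\,R\right)$; and its computational costs, counted in operations in $\mathsf{GR}$, are - encoding: $\tilde O\left(\frac{trv+sru}{uvw}\,\sqrt m\,N\log^2N\right)$; - decoding: $\tilde O\left(\frac{ts}{uv}\,R\log^2R\right)$; - computation of each worker node: $\tilde O\left(\frac{tsr}{uvw}\right)$.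
   Context: **Galois rings.** For a prime $p$ and integers $e,d\ge1$, $\mathsf{GR}(p^e,d)=\mathbb{Z}_{p^e}[x]/(f(x))$, where $f$ is monic of degree $d$ and irreducible modulo $p$. Write $\mathsf{GR}=\mathsf{GR}(p^e,d)$ and $\mathsf{GR}_k=\mathsf{GR}(p^e,dk)$, the extension of $\mathsf{GR}$ of degree $k$. An element of $\mathsf{GR}_k$ is represented by $k$ elements of $\mathsf{GR}$. A subset of a Galois ring is exceptional if the difference of any two distinct elements is invertible; $\mathsf{GR}_k$ has an exceptional set $T$ of size $p^{dk}$ (representatives modulo $p$). **RMFE.** For a Galois ring $S=\mathsf{GR}(p^e,d')$ and $S'=\mathsf{GR}(p^e,d'k)$, an $(n,k)$-RMFE over $S$ is a pair $(\phi,\psi)$ of $S$-linear maps $\phi:S^n\to S'$, $\psi:S'\to S^n$ with $\psi(\phi(\mathbf x)\phi(\mathbf y))=\mathbf x\star\mathbf y$ for all $\mathbf x,\mathbf y\in S^n$, where $\star$ is the componentwise product. Standing assumption: $(\phi_1,\psi_1)$ is a fixed $(n,\sqrt m)$-RMFE over $\mathsf{GR}$, with $\mathsf{GR}^n\xrightarrow{\phi_1}\mathsf{GR}_{\sqrt m}\xrightarrow{\psi_1}\mathsf{GR}^n$, and $(\phi_2,\psi_2)$ is a fixed $(n,\sqrt m)$-RMFE over $\mathsf{GR}_{\sqrt m}$, with $\mathsf{GR}_{\sqrt m}^n\xrightarrow{\phi_2}\mathsf{GR}_m\xrightarrow{\psi_2}\mathsf{GR}_{\sqrt m}^n$. Each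 evaluation of one of these maps costs $O(k\log^2k\log\log k)$ operations in the base ring of the RMFE, where $k=\sqrt m$. **Cost model and notation.** Costs are counted in operations in $\mathsf{GR}$ (computation) or elements of $\mathsf{GR}$ (communication). One arithmetic operation in $\mathsf{GR}_k$ costs $O(k\log^2k\log\log k)$ operations in $\mathsf{GR}$. Evaluating a polynomial of degree less than $\ell$ over a Galois ring at $\ell$ points of an exceptional set $T$, or interpolating such a polynomial from its values at those points, costs $O(\ell\log^2\ell\log\log\ell)$ operations in that ring. Worker nodes multiply an $a\times b$ by a $b\times c$ matrix using $O(abc)$ ring operations. $\tilde O$ omits factors polynomial in $\log\log N$. Here $p,e,d$ are fixed, and implied constants are independent of $t,r,s,u,v,w,n,N$ (they may depend on the constants in $n=\Theta(\sqrt m)$). $N\ge2$, and $\log x$, $\log\log x$ inside $O$/$\tilde O$ are read as at least $1$. **Distributed model.** A master node encodes the inputs and sends data to each of $N$ worker nodes (upload is the total amount sent). Each worker computes a local product and returns it. The recovery threshold is $R$ if the responses of any $R$ workers suffice for the master to recover the desired output. Download is the total amount received from $R$ workers. Encoding (resp. decoding) complexity is the cost of the master's computation before sending (resp. after receiving). **EP codes over $\mathsf{GR}_m$.** Given $\mathbb A\in\mathsf{GR}_m^{t'\times r'}$, $\mathbb B\in\mathsf{GR}_m^{r'\times s'}$ and $u\mid t'$, $v\mid s'$, $w\mid r'$, partition $\mathbb A=(\mathbb A_{ij})_{1\le i\le u,1\le j\le w}$ with blocks of size $\frac{t'}u\times\frac{r'}w$ and $\mathbb B=(\mathbb B_{k\ell})_{1\le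 k\le w,1\le\ell\le v}$ with blocks of size $\frac{r'}w\times\frac{s'}v$. Set $f(x)=\sum_{i,j}\mathbb A_{ij}x^{(i-1)w+j-1}$, $g(x)=\sum_{k,\ell}\mathbb B_{k\ell}x^{w-k+(\ell-1)uw}$. For $N\le p^{dm}$ distinct points $\alpha_1,\dots,\alpha_N$ of an exceptional set of $\mathsf{GR}_m$, the master sends $f(\alpha_i),g(\alpha_i)$ to worker $i$, who returns $h(\alpha_i)=f(\alpha_i)g(\alpha_i)$. The master interpolates $h=fg$ from $R=uvw+w-1$ responses and reads the blocks $\sum_j\mathbb A_{ij}\mathbb B_{j\ell}$ of $\mathbb{AB}$ off the coefficients of $h$. **Packing/unpacking.** Packing matrices $M_1,\dots,M_n$ of equal size with a map $\phi$ means forming the matrix with entries $\phi(M_1[i,j],\dots,M_n[i,j])$; unpacking a matrix $M$ with $\psi$ means forming the $n$ matrices $M_1,\dots,M_n$ with $(M_1[i,j],\dots,M_n[i,j])=\psi(M[i,j])$. **$\widetilde{\mathsf{EP}}_{\mathsf{RMFE}}$-II.** (1) Partition $A$ into row blocks $A_1,\dots,A_n\in\mathsf{GR}^{\frac tn\times r}$ (stacked vertically) and $B=(B_1\ \cdots\ B_n)$ into column blocks $B_j\in\mathsf{GR}^{r\times\frac sn}$. (2) Use $\phi_1$ to pack the constant batch $\{A_i,A_i,\dots,A_i\}$ ($n$ copies) into $\mathcal A_i\in\mathsf{GR}_{\sqrt m}^{\frac tn\times r}$ for each $1\le i\le n$, and $\{B_1,\dots,B_n\}$ into $\mathcal B\in\mathsf{GR}_{\sqrt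 m}^{r\times\frac sn}$. (3) Use $\phi_2$ to pack $\{\mathcal A_1,\dots,\mathcal A_n\}$ into $\mathbb A\in\mathsf{GR}_m^{\frac tn\times r}$ and the constant batch $\{\mathcal B,\dots,\mathcal B\}$ into $\mathbb B\in\mathsf{GR}_m^{r\times\frac sn}$. Run EP codes over $\mathsf{GR}_m$ with parameters $u,v,w$ and $N$ workers to compute $\mathbb C=\mathbb{AB}$. Use $\psi_2$ to unpack $\mathbb C$ into $\{\mathcal A_1\mathcal B,\dots,\mathcal A_n\mathcal B\}$. (4) For each $i$, use $\psi_1$ to unpack $\mathcal A_i\mathcal B$ into $\{A_iB_1,\dots,A_iB_n\}$, and output the block matrix $C=(A_iB_j)_{1\le i,j\le n}=AB$. All packing belongs to encoding and all unpacking belongs to decoding. *)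

theory Defs
  imports
    "HOL-Algebra.UnivPoly"
    "HOL-Algebra.QuotRing"
    "HOL-Algebra.Ring_Divisibility"
    "HOL-Number_Theory.Residues"
    "HOL-Library.FuncSet"
    "HOL-Library.Monad_Syntax"
    "Jordan_Normal_Form.Matrix"
begin

section \<open>Galois rings and RMFEs\<close>

text \<open>
  \<^term>\<open>galois_ring p e d S\<close>: \<^term>\<open>S\<close> is literally \<open>Z_{p^e}[x]/(f)\<close> for some monic \<open>f\<close> of degree
  \<^term>\<open>d\<close> that is irreducible modulo \<^term>\<open>p\<close>. All Galois rings have the same HOL type, which allows
  quantification over the degree of an extension.
\<close>

type_synonym gr_elem = "(nat \<Rightarrow> int) set"

definition galois_ring :: "nat \<Rightarrow> nat \<Rightarrow> nat \<Rightarrow> gr_elem ring \<Rightarrow> bool" where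
  "galois_ring p e d S \<longleftrightarrow> prime p \<and> e \<ge> 1 \<and> d \<ge> 1 \<and>
     (let Z = residue_ring (int p ^ e); P = UP Z in
      \<exists>f \<in> carrier P.
        deg Z f = d \<and> up_ring.coeff P f d = 1 \<and>
        ring_irreducible\<^bsub>UP (residue_ring (int p))\<^esub> (\<lambda>i. up_ring.coeff P f i mod int p) \<and>
        S = P Quot (PIdl\<^bsub>P\<^esub> f))"

definition exceptional :: "('a, 'z) ring_scheme \<Rightarrow> 'a set \<Rightarrow> bool" where
  "exceptional S T \<longleftrightarrow>
     T \<subseteq> carrier S \<and> (\<forall>x\<in>T. \<forall>y\<in>T. x \<noteq> y \<longrightarrow> x \<ominus>\<^bsub>S\<^esub> y \<in> Units S)"

text \<open>The vector and matrix types only serve as containers; their library arithmetic belongs to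
  type-class rings, so the operations over a ring record are given here.\<close>

definition vecs :: "('a, 'z) ring_scheme \<Rightarrow> nat \<Rightarrow> 'a vec set" where
  "vecs S n = {x \<in> carrier_vec n. \<forall>i<n. x $ i \<in> carrier S}"

definition mats :: "('a, 'z) ring_scheme \<Rightarrow> nat \<Rightarrow> nat \<Rightarrow> 'a mat set" where
  "mats S a b = {M \<in> carrier_mat a b. elements_mat M \<subseteq> carrier S}"

definition vec_plus :: "('a, 'z) ring_scheme \<Rightarrow> 'a vec \<Rightarrow> 'a vec \<Rightarrow> 'a vec" where
  "vec_plus S x y = vec (dim_vec x) (\<lambda>i. x $ i \<oplus>\<^bsub>S\<^esub> y $ i)"

definition vec_scale :: "('a, 'z) ring_scheme \<Rightarrow> 'a \<Rightarrow> 'a vec \<Rightarrow> 'a vec" where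
  "vec_scale S a x = vec (dim_vec x) (\<lambda>i. a \<otimes>\<^bsub>S\<^esub> x $ i)"

definition vec_star :: "('a, 'z) ring_scheme \<Rightarrow> 'a vec \<Rightarrow> 'a vec \<Rightarrow> 'a vec" where
  "vec_star S x y = vec (dim_vec x) (\<lambda>i. x $ i \<otimes>\<^bsub>S\<^esub> y $ i)"

definition mat_mult :: "('a, 'z) ring_scheme \<Rightarrow> 'a mat \<Rightarrow> 'a mat \<Rightarrow> 'a mat" where
  "mat_mult S A B = mat (dim_row A) (dim_col B)
     (\<lambda>(i, j). \<Oplus>\<^bsub>S\<^esub>l\<in>{..<dim_col A}. A $$ (i, l) \<otimes>\<^bsub>S\<^esub> B $$ (l, j))"

text \<open>A pair of maps \<open>(\<phi>, \<psi>)\<close>, each with the number of operations in the base ring that one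
  evaluation takes.\<close>

record ('a, 'b) rmfe =
  phi :: "'a vec \<Rightarrow> 'b"
  psi :: "'b \<Rightarrow> 'a vec"
  phi_ops :: nat
  psi_ops :: nat

text \<open>The extension \<^term>\<open>S'\<close> of \<^term>\<open>S\<close> is given by a (necessarily injective) ring homomorphism
  \<^term>\<open>\<iota>\<close>, through which \<^term>\<open>S\<close> acts on \<^term>\<open>S'\<close>.\<close>

definition is_RMFE :: "nat \<Rightarrow> nat \<Rightarrow> nat \<Rightarrow> nat \<Rightarrow> nat \<Rightarrow>
    gr_elem ring \<Rightarrow> gr_elem ring \<Rightarrow> (gr_elem \<Rightarrow> gr_elem) \<Rightarrow>
    (gr_elem, gr_elem) rmfe \<Rightarrow> bool" where
  "is_RMFE p e d' n k S S' \<iota> \<Phi> \<longleftrightarrow>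
     galois_ring p e d' S \<and> galois_ring p e (d' * k) S' \<and> \<iota> \<in> Ring.ring_hom S S' \<and>
     phi \<Phi> \<in> vecs S n \<rightarrow> carrier S' \<and>
     (\<forall>x\<in>vecs S n. \<forall>y\<in>vecs S n. phi \<Phi> (vec_plus S x y) = phi \<Phi> x \<oplus>\<^bsub>S'\<^esub> phi \<Phi> y) \<and>
     (\<forall>a\<in>carrier S. \<forall>x\<in>vecs S n. phi \<Phi> (vec_scale S a x) = \<iota> a \<otimes>\<^bsub>S'\<^esub> phi \<Phi> x) \<and>
     psi \<Phi> \<in> carrier S' \<rightarrow> vecs S n \<and>
     (\<forall>x\<in>carrier S'. \<forall>y\<in>carrier S'. psi \<Phi> (x \<oplus>\<^bsub>S'\<^esub> y) = vec_plus S (psi \<Phi> x) (psi \<Phi> y)) \<and>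
     (\<forall>a\<in>carrier S. \<forall>x\<in>carrier S'. psi \<Phi> (\<iota> a \<otimes>\<^bsub>S'\<^esub> x) = vec_scale S a (psi \<Phi> x)) \<and>
     (\<forall>x\<in>vecs S n. \<forall>y\<in>vecs S n. psi \<Phi> (phi \<Phi> x \<otimes>\<^bsub>S'\<^esub> phi \<Phi> y) = vec_star S x y)"


section \<open>Cost model\<close>

definition lg :: "real \<Rightarrow> real" where
  "lg x = max 1 (ln x)"

text \<open>For \<open>x \<ge> exp 1\<close> this is \<open>max 1 (ln (ln x))\<close>; the inner \<^const>\<open>lg\<close> keeps the argument of the outer
  logarithm positive.\<close>

definition lglg :: "real \<Rightarrow> real" where
  "lglg x = max 1 (ln (lg x))"

definition quasilin :: "real \<Rightarrow> real" where
  "quasilin x = x * (lg x)^2 * lglg x"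

text \<open>
  Costs of the black-box primitives, as functions of the relative degree \<open>k\<close> of the ring \<open>GR_k\<close> they
  work in. Only \<open>ext_op\<close> counts operations in \<open>GR\<close> itself (for one operation in \<open>GR_k\<close>); the other
  primitives count operations in \<open>GR_k\<close>.
\<close>

record op_costs =
  ext_op :: "nat \<Rightarrow> nat"
  eval_ops :: "nat \<Rightarrow> nat \<Rightarrow> nat"
  interp_ops :: "nat \<Rightarrow> nat \<Rightarrow> nat"
  matmul_ops :: "nat \<Rightarrow> nat \<Rightarrow> nat \<Rightarrow> nat \<Rightarrow> nat"

definition cost_model :: "real \<Rightarrow> op_costs \<Rightarrow> bool" where
  "cost_model K cm \<longleftrightarrow>
     (\<forall>k\<ge>1. real (ext_op cm k) \<le> K * quasilin (real k)) \<and>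
     (\<forall>k\<ge>1. \<forall>l\<ge>1. real (eval_ops cm k l) \<le> K * quasilin (real l)) \<and>
     (\<forall>k\<ge>1. \<forall>l\<ge>1. real (interp_ops cm k l) \<le> K * quasilin (real l)) \<and>
     (\<forall>k\<ge>1. \<forall>a\<ge>1. \<forall>b\<ge>1. \<forall>c\<ge>1. real (matmul_ops cm k a b c) \<le> K * real (a * b * c))"

definition rmfe_cost :: "real \<Rightarrow> nat \<Rightarrow> ('a, 'b) rmfe \<Rightarrow> bool" where
  "rmfe_cost K k \<Phi> \<longleftrightarrow>
     real (phi_ops \<Phi>) \<le> K * quasilin (real k) \<and> real (psi_ops \<Phi>) \<le> K * quasilin (real k)"

text \<open>A computed value together with the number of operations in \<open>GR\<close> spent on it. The schemes below
  manipulate ring elements only through the primitives charged here; the remaining steps just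
  rearrange data.\<close>

datatype 'a costed = Costed (val: 'a) (cost: nat)

definition ret :: "'a \<Rightarrow> 'a costed" where
  "ret x = Costed x 0"

definition bind_costed :: "'a costed \<Rightarrow> ('a \<Rightarrow> 'b costed) \<Rightarrow> 'b costed" where
  "bind_costed c g = Costed (val (g (val c))) (cost c + cost (g (val c)))"

adhoc_overloading Monad_Syntax.bind \<rightleftharpoons> bind_costed

definition family_costed :: "nat \<Rightarrow> (nat \<Rightarrow> 'a costed) \<Rightarrow> (nat \<Rightarrow> 'a) costed" where
  "family_costed n F = Costed (\<lambda>i. val (F i)) (\<Sum>i<n. cost (F i))"

definition mat_costed :: "nat \<Rightarrow> nat \<Rightarrow> (nat \<times> nat \<Rightarrow> 'a costed) \<Rightarrow> 'a mat costed" where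
  "mat_costed a b F =
     Costed (mat a b (\<lambda>ij. val (F ij))) (\<Sum>i<a. \<Sum>j<b. cost (F (i, j)))"

definition poly_val :: "('a, 'z) ring_scheme \<Rightarrow> 'a vec \<Rightarrow> 'a \<Rightarrow> 'a" where
  "poly_val S c x = (\<Oplus>\<^bsub>S\<^esub>q\<in>{..<dim_vec c}. c $ q \<otimes>\<^bsub>S\<^esub> x [^]\<^bsub>S\<^esub> q)"

text \<open>In the following primitives \<^term>\<open>S\<close> is \<open>GR_k\<close>, and polynomials of degree less than \<open>l\<close> are
  coefficient vectors of dimension \<open>l\<close>.\<close>

definition multi_eval ::
    "('a, 'z) ring_scheme \<Rightarrow> op_costs \<Rightarrow> nat \<Rightarrow> (nat \<Rightarrow> 'a) \<Rightarrow> 'a vec \<Rightarrow> 'a vec costed" where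
  "multi_eval S cm k \<alpha> c =
     Costed (vec (dim_vec c) (\<lambda>i. poly_val S c (\<alpha> i))) (eval_ops cm k (dim_vec c) * ext_op cm k)"

text \<open>The polynomial of degree less than \<^term>\<open>card J\<close> with value \<^term>\<open>y i\<close> at \<^term>\<open>\<alpha> i\<close> for
  \<^term>\<open>i \<in> J\<close>; it is unique when the \<^term>\<open>\<alpha> i\<close> are distinct elements of an exceptional set.\<close>

definition interpolate :: "('a, 'z) ring_scheme \<Rightarrow> op_costs \<Rightarrow> nat \<Rightarrow> (nat \<Rightarrow> 'a) \<Rightarrow>
    nat set \<Rightarrow> (nat \<Rightarrow> 'a) \<Rightarrow> 'a vec costed" where
  "interpolate S cm k \<alpha> J y =
     Costed (SOME c. c \<in> vecs S (card J) \<and> (\<forall>i\<in>J. poly_val S c (\<alpha> i) = y i))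
            (interp_ops cm k (card J) * ext_op cm k)"

definition local_mult ::
    "('a, 'z) ring_scheme \<Rightarrow> op_costs \<Rightarrow> nat \<Rightarrow> 'a mat \<Rightarrow> 'a mat \<Rightarrow> 'a mat costed" where
  "local_mult S cm k P Q =
     Costed (mat_mult S P Q) (matmul_ops cm k (dim_row P) (dim_col P) (dim_col Q) * ext_op cm k)"


section \<open>Distributed schemes\<close>

text \<open>The decoder is given the set of responding workers and a function with their responses. Sizes
  count elements of \<open>GR\<close>, costs count operations in \<open>GR\<close>. Workers are numbered from \<open>0\<close>.\<close>

record ('x, 'msg, 'res, 'y) dist_scheme =
  encode :: "'x \<Rightarrow> (nat \<Rightarrow> 'msg) costed"
  work :: "'msg \<Rightarrow> 'res costed"
  decode :: "nat set \<Rightarrow> (nat \<Rightarrow> 'res) \<Rightarrow> 'y costed"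
  msg_size :: "'msg \<Rightarrow> nat"
  res_size :: "'res \<Rightarrow> nat"

definition message :: "('x, 'msg, 'res, 'y) dist_scheme \<Rightarrow> 'x \<Rightarrow> nat \<Rightarrow> 'msg" where
  "message D x i = val (encode D x) i"

definition response :: "('x, 'msg, 'res, 'y) dist_scheme \<Rightarrow> 'x \<Rightarrow> nat \<Rightarrow> 'res" where
  "response D x i = val (work D (message D x i))"

definition decoding :: "('x, 'msg, 'res, 'y) dist_scheme \<Rightarrow> 'x \<Rightarrow> nat set \<Rightarrow> 'y costed" where
  "decoding D x J = decode D J (restrict (response D x) J)"

definition computes_with_recovery_threshold ::
    "nat \<Rightarrow> ('x, 'msg, 'res, 'y) dist_scheme \<Rightarrow> 'x set \<Rightarrow> ('x \<Rightarrow> 'y) \<Rightarrow> nat \<Rightarrow> bool" where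
  "computes_with_recovery_threshold N D Inp F R \<longleftrightarrow>
     (\<forall>x\<in>Inp. \<forall>J\<subseteq>{..<N}. card J = R \<longrightarrow> val (decoding D x J) = F x)"

definition upload :: "nat \<Rightarrow> ('x, 'msg, 'res, 'y) dist_scheme \<Rightarrow> 'x \<Rightarrow> nat" where
  "upload N D x = (\<Sum>i<N. msg_size D (message D x i))"

definition download :: "('x, 'msg, 'res, 'y) dist_scheme \<Rightarrow> 'x \<Rightarrow> nat set \<Rightarrow> nat" where
  "download D x J = (\<Sum>i\<in>J. res_size D (response D x i))"

definition encoding_cost :: "('x, 'msg, 'res, 'y) dist_scheme \<Rightarrow> 'x \<Rightarrow> nat" where
  "encoding_cost D x = cost (encode D x)"

definition worker_cost :: "('x, 'msg, 'res, 'y) dist_scheme \<Rightarrow> 'x \<Rightarrow> nat \<Rightarrow> nat" where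
  "worker_cost D x i = cost (work D (message D x i))"

definition decoding_cost :: "('x, 'msg, 'res, 'y) dist_scheme \<Rightarrow> 'x \<Rightarrow> nat set \<Rightarrow> nat" where
  "decoding_cost D x J = cost (decoding D x J)"

text \<open>An element of \<open>GR_k\<close> takes \<open>k\<close> elements of \<open>GR\<close>.\<close>

definition mat_size :: "nat \<Rightarrow> 'a mat \<Rightarrow> nat" where
  "mat_size k M = k * (dim_row M * dim_col M)"


section \<open>EP codes\<close>

text \<open>Block indices start at \<open>0\<close>, so that an exponent \<open>(i-1)w+j-1\<close> becomes \<open>i*w+j\<close>, and
  \<open>w-k+(l-1)uw\<close> becomes \<open>(w-1-k)+l*u*w\<close>.\<close>

definition block :: "nat \<Rightarrow> nat \<Rightarrow> 'a mat \<Rightarrow> nat \<Rightarrow> nat \<Rightarrow> 'a mat" where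
  "block a b M i j = mat a b (\<lambda>(x, y). M $$ (i * a + x, j * b + y))"

text \<open>Coefficients of the polynomial with monomials \<open>M i j x^(\<epsilon> i j)\<close>, \<open>i < a\<close>, \<open>j < b\<close>. In the
  encoder the exponents are pairwise distinct, so each sum has at most one term and collecting the
  coefficients involves no ring operation; they are less than \<open>N\<close> because \<open>uvw + w - 1 \<le> N\<close>.\<close>

definition coeff_vec ::
    "('a, 'z) ring_scheme \<Rightarrow> nat \<Rightarrow> nat \<Rightarrow> nat \<Rightarrow> (nat \<Rightarrow> nat \<Rightarrow> nat) \<Rightarrow> (nat \<Rightarrow> nat \<Rightarrow> 'a) \<Rightarrow> 'a vec" where
  "coeff_vec S l a b \<epsilon> M =
     vec l (\<lambda>q. finsum S (\<lambda>(i, j). M i j) {(i, j). i < a \<and> j < b \<and> \<epsilon> i j = q})"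

text \<open>Values at \<open>N\<close> points of the matrix polynomial with blocks \<open>M i j\<close> of size \<open>x\<close> by \<open>y\<close>, entry by
  entry.\<close>

definition eval_blocks :: "('a, 'z) ring_scheme \<Rightarrow> op_costs \<Rightarrow> nat \<Rightarrow> (nat \<Rightarrow> 'a) \<Rightarrow> nat \<Rightarrow>
    nat \<Rightarrow> nat \<Rightarrow> (nat \<Rightarrow> nat \<Rightarrow> nat) \<Rightarrow> nat \<Rightarrow> nat \<Rightarrow> (nat \<Rightarrow> nat \<Rightarrow> 'a mat) \<Rightarrow>
    (nat \<Rightarrow> 'a mat) costed" where
  "eval_blocks S cm m \<alpha> N a b \<epsilon> x y M = do {
     V \<leftarrow> mat_costed x y
       (\<lambda>xy. multi_eval S cm m \<alpha> (coeff_vec S N a b \<epsilon> (\<lambda>i j. M i j $$ xy)));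
     ret (\<lambda>i. map_mat (\<lambda>c. c $ i) V)
   }"

definition ep_encode :: "('a, 'z) ring_scheme \<Rightarrow> op_costs \<Rightarrow> nat \<Rightarrow> (nat \<Rightarrow> 'a) \<Rightarrow> nat \<Rightarrow>
    nat \<Rightarrow> nat \<Rightarrow> nat \<Rightarrow> nat \<Rightarrow> nat \<Rightarrow> nat \<Rightarrow> 'a mat \<times> 'a mat \<Rightarrow> (nat \<Rightarrow> 'a mat \<times> 'a mat) costed" where
  "ep_encode S cm m \<alpha> N u v w t r s = (\<lambda>(A, B). do {
     f \<leftarrow> eval_blocks S cm m \<alpha> N u w (\<lambda>i j. i * w + j)
            (t div u) (r div w) (block (t div u) (r div w) A);
     g \<leftarrow> eval_blocks S cm m \<alpha> N w v (\<lambda>k l. (w - 1 - k) + l * (u * w))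
            (r div w) (s div v) (block (r div w) (s div v) B);
     ret (\<lambda>i. (f i, g i))
   })"

text \<open>The block in position \<open>(i, l)\<close> of the product is the coefficient of \<open>x^(i*w + (w-1) + l*u*w)\<close>.\<close>

definition ep_decode :: "('a, 'z) ring_scheme \<Rightarrow> op_costs \<Rightarrow> nat \<Rightarrow> (nat \<Rightarrow> 'a) \<Rightarrow>
    nat \<Rightarrow> nat \<Rightarrow> nat \<Rightarrow> nat \<Rightarrow> nat \<Rightarrow> nat set \<Rightarrow> (nat \<Rightarrow> 'a mat) \<Rightarrow> 'a mat costed" where
  "ep_decode S cm m \<alpha> u v w t s J Y = do {
     H \<leftarrow> mat_costed (t div u) (s div v)
       (\<lambda>xy. interpolate S cm m \<alpha> J (\<lambda>i. Y i $$ xy));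
     ret (mat t s (\<lambda>(x, y).
       let i = x div (t div u); l = y div (s div v)
       in H $$ (x mod (t div u), y mod (s div v)) $ (i * w + (w - 1) + l * (u * w))))
   }"

definition EP_code :: "('a, 'z) ring_scheme \<Rightarrow> op_costs \<Rightarrow> nat \<Rightarrow> (nat \<Rightarrow> 'a) \<Rightarrow> nat \<Rightarrow>
    nat \<Rightarrow> nat \<Rightarrow> nat \<Rightarrow> nat \<Rightarrow> nat \<Rightarrow> nat \<Rightarrow>
    ('a mat \<times> 'a mat, 'a mat \<times> 'a mat, 'a mat, 'a mat) dist_scheme" where
  "EP_code S cm m \<alpha> N u v w t r s = \<lparr>
     encode = ep_encode S cm m \<alpha> N u v w t r s,
     work = (\<lambda>(P, Q). local_mult S cm m P Q),
     decode = ep_decode S cm m \<alpha> u v w t s,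
     msg_size = (\<lambda>(P, Q). mat_size m P + mat_size m Q),
     res_size = mat_size m \<rparr>"


section \<open>The scheme EP-RMFE-II\<close>

text \<open>Packing and unpacking of matrices of size \<open>a\<close> by \<open>b\<close>; \<open>base\<close> is the cost, in operations in \<open>GR\<close>,
  of one operation in the base ring of the RMFE.\<close>

definition pack_mats :: "('a, 'b) rmfe \<Rightarrow> nat \<Rightarrow> nat \<Rightarrow> nat \<Rightarrow> nat \<Rightarrow> (nat \<Rightarrow> 'a mat) \<Rightarrow> 'b mat costed" where
  "pack_mats \<Phi> base n a b M = mat_costed a b
     (\<lambda>xy. Costed (phi \<Phi> (vec n (\<lambda>l. M l $$ xy))) (phi_ops \<Phi> * base))"

definition unpack_mat :: "('a, 'b) rmfe \<Rightarrow> nat \<Rightarrow> nat \<Rightarrow> nat \<Rightarrow> 'b mat \<Rightarrow> (nat \<Rightarrow> 'a mat) costed" where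
  "unpack_mat \<Phi> base a b M = do {
     V \<leftarrow> mat_costed a b (\<lambda>xy. Costed (psi \<Phi> (M $$ xy)) (psi_ops \<Phi> * base));
     ret (\<lambda>l. map_mat (\<lambda>c. c $ l) V)
   }"

text \<open>\<open>\<Phi>1\<close> is an RMFE over \<open>GR\<close> and \<open>\<Phi>2\<close> one over \<open>GR_k\<close>, where \<open>k = \<surd>m\<close>; \<open>S\<close> is \<open>GR_m\<close>.\<close>

definition pack_inputs :: "op_costs \<Rightarrow> nat \<Rightarrow> ('a, 'b) rmfe \<Rightarrow> ('b, 'c) rmfe \<Rightarrow>
    nat \<Rightarrow> nat \<Rightarrow> nat \<Rightarrow> nat \<Rightarrow> 'a mat \<times> 'a mat \<Rightarrow> ('c mat \<times> 'c mat) costed" where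
  "pack_inputs cm k \<Phi>1 \<Phi>2 n t r s = (\<lambda>(A, B). do {
     A1 \<leftarrow> family_costed n (\<lambda>i. pack_mats \<Phi>1 1 n (t div n) r (\<lambda>_. block (t div n) r A i 0));
     B1 \<leftarrow> pack_mats \<Phi>1 1 n r (s div n) (\<lambda>j. block r (s div n) B 0 j);
     A2 \<leftarrow> pack_mats \<Phi>2 (ext_op cm k) n (t div n) r A1;
     B2 \<leftarrow> pack_mats \<Phi>2 (ext_op cm k) n r (s div n) (\<lambda>_. B1);
     ret (A2, B2)
   })"

definition unpack_output :: "op_costs \<Rightarrow> nat \<Rightarrow> ('a, 'b) rmfe \<Rightarrow> ('b, 'c) rmfe \<Rightarrow>
    nat \<Rightarrow> nat \<Rightarrow> nat \<Rightarrow> 'c mat \<Rightarrow> 'a mat costed" where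
  "unpack_output cm k \<Phi>1 \<Phi>2 n t s C2 = do {
     C1 \<leftarrow> unpack_mat \<Phi>2 (ext_op cm k) (t div n) (s div n) C2;
     C \<leftarrow> family_costed n (\<lambda>i. unpack_mat \<Phi>1 1 (t div n) (s div n) (C1 i));
     ret (mat t s (\<lambda>(x, y).
       C (x div (t div n)) (y div (s div n)) $$ (x mod (t div n), y mod (s div n))))
   }"

definition EP_RMFE_II :: "('c, 'z) ring_scheme \<Rightarrow> op_costs \<Rightarrow> nat \<Rightarrow> nat \<Rightarrow>
    ('a, 'b) rmfe \<Rightarrow> ('b, 'c) rmfe \<Rightarrow> (nat \<Rightarrow> 'c) \<Rightarrow> nat \<Rightarrow> nat \<Rightarrow>
    nat \<Rightarrow> nat \<Rightarrow> nat \<Rightarrow> nat \<Rightarrow> nat \<Rightarrow> nat \<Rightarrow>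
    ('a mat \<times> 'a mat, 'c mat \<times> 'c mat, 'c mat, 'a mat) dist_scheme" where
  "EP_RMFE_II S cm k m \<Phi>1 \<Phi>2 \<alpha> N n u v w t r s =
     (let EP = EP_code S cm m \<alpha> N u v w (t div n) r (s div n) in \<lparr>
        encode = (\<lambda>AB. do { P \<leftarrow> pack_inputs cm k \<Phi>1 \<Phi>2 n t r s AB; encode EP P }),
        work = work EP,
        decode = (\<lambda>J Y. do { C2 \<leftarrow> decode EP J Y; unpack_output cm k \<Phi>1 \<Phi>2 n t s C2 }),
        msg_size = msg_size EP,
        res_size = res_size EP \<rparr>)"

end

theory Submission
  imports Defs
begin

text \<open>
  Correctness of the EP code: over any commutative ring a polynomial with \<open>l\<close> coefficients and \<open>l\<close>
  roots in an exceptional set vanishes, since dividing by \<open>x - a\<close> leaves roots at all other points.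
  Hence interpolation from \<open>R\<close> responses returns \<open>h = f g\<close>, which has degree at most \<open>R - 1\<close>. In the
  monomial \<open>x^((i + l u) w + (w - 1) + (j - k))\<close> of \<open>A_ij B_kl\<close> the condition \<open>|j - k| < w\<close> makes the
  exponents with remainder \<open>w - 1\<close> modulo \<open>w\<close> collect exactly the terms with \<open>j = k\<close>. Since \<open>\<psi>\<close> is
  additive and turns products of packed entries into componentwise products, unpacking a product of
  packed matrices gives the batch of products, once for each of the two RMFEs.

  Costs: \<open>m\<close> is \<open>O(log N)\<close>, so every operation in \<open>GR_m\<close> costs \<open>m\<close> times a power of \<open>log log N\<close>.
  The factors \<open>m = k^2\<close> and \<open>k\<close> coming from element sizes and RMFE evaluations are paid for by the
  factors \<open>n \<ge> c1 k\<close> gained from batching, and packing and unpacking are dominated by the EP code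
  because \<open>u w\<close>, \<open>v w\<close> are at most \<open>N\<close> and \<open>u v\<close> is at most \<open>R\<close>.
\<close>

lemma galois_ring_cring:
  assumes "galois_ring p e d S"
  shows "cring S"
proof -
  define Z where "Z = residue_ring (int p ^ e)"
  have p: "prime p" and e: "e \<ge> 1" using assms by (auto simp: galois_ring_def)
  obtain f where f: "f \<in> carrier (UP Z)" and S: "S = UP Z Quot (PIdl\<^bsub>UP Z\<^esub> f)"
    using assms by (auto simp: galois_ring_def Let_def Z_def)
  have "int p ^ e > 1" using prime_gt_1_nat[OF p] e by (intro one_less_power) auto
  then interpret Z: residues "int p ^ e" Z by unfold_locales (simp_all add: Z_def)
  have "UP_cring Z" by (rule UP_cring.intro) (rule Z.cring)
  then interpret P: UP_cring Z "UP Z" by simp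
  show ?thesis
    unfolding S by (rule ideal.quotient_is_cring[OF P.cgenideal_ideal[OF f] P.P.is_cring])
qed

lemma matsI:
  assumes "dim_row M = a" "dim_col M = b" "\<And>i j. i < a \<Longrightarrow> j < b \<Longrightarrow> M $$ (i, j) \<in> carrier S"
  shows "M \<in> mats S a b"
  using assms by (auto simp: mats_def elements_mat_def)

lemma matsD:
  assumes "M \<in> mats S a b"
  shows "dim_row M = a" "dim_col M = b" "i < a \<Longrightarrow> j < b \<Longrightarrow> M $$ (i, j) \<in> carrier S"
  using assms by (force simp: mats_def elements_mat_def)+

lemma vecsI:
  assumes "dim_vec x = n" "\<And>i. i < n \<Longrightarrow> x $ i \<in> carrier S"
  shows "x \<in> vecs S n"
  using assms by (auto simp: vecs_def)

lemma vecsD: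
  assumes "x \<in> vecs S n"
  shows "dim_vec x = n" "i < n \<Longrightarrow> x $ i \<in> carrier S"
  using assms by (auto simp: vecs_def)

lemma (in abelian_monoid) finsum_fibers:
  assumes "finite X" "finite I" "g \<in> X \<rightarrow> I" "f \<in> X \<rightarrow> carrier G"
  shows "(\<Oplus>i\<in>I. \<Oplus>x\<in>{x\<in>X. g x = i}. f x) = (\<Oplus>x\<in>X. f x)"
proof -
  have "X = (\<Union>i\<in>I. {x\<in>X. g x = i})" using assms(3) by auto
  moreover have "finsum G f (\<Union>i\<in>I. {x\<in>X. g x = i}) = (\<Oplus>i\<in>I. \<Oplus>x\<in>{x\<in>X. g x = i}. f x)"
    by (rule add.finprod_UN_disjoint) (use assms in \<open>auto simp: pairwise_def disjnt_def\<close>)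
  ultimately show ?thesis by metis
qed

lemma (in abelian_monoid) finsum_cartesian_product:
  assumes "finite A" "finite B" "f \<in> A \<times> B \<rightarrow> carrier G"
  shows "(\<Oplus>a\<in>A. \<Oplus>b\<in>B. f (a, b)) = (\<Oplus>x\<in>A \<times> B. f x)"
proof -
  have "(\<Oplus>b\<in>B. f (a, b)) = (\<Oplus>x\<in>{x\<in>A \<times> B. fst x = a}. f x)" if "a \<in> A" for a
  proof -
    have "{x\<in>A \<times> B. fst x = a} = Pair a ` B" using that by auto
    moreover have "finsum G f (Pair a ` B) = (\<Oplus>b\<in>B. f (a, b))"
      by (rule finsum_reindex) (use assms that in \<open>auto simp: inj_on_def\<close>)
    ultimately show ?thesis by simp
  qed
  then have "(\<Oplus>a\<in>A. \<Oplus>b\<in>B. f (a, b)) = (\<Oplus>a\<in>A. \<Oplus>x\<in>{x\<in>A \<times> B. fst x = a}. f x)"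
    using assms by (intro finsum_cong') (auto intro!: finsum_closed)
  also have "\<dots> = (\<Oplus>x\<in>A \<times> B. f x)"
    by (rule finsum_fibers) (use assms in auto)
  finally show ?thesis .
qed

lemma (in abelian_monoid) finsum_lessThan_Suc_shift:
  assumes "f \<in> {..<Suc l} \<rightarrow> carrier G"
  shows "(\<Oplus>q\<in>{..<Suc l}. f q) = f 0 \<oplus> (\<Oplus>q\<in>{..<l}. f (Suc q))"
proof -
  have "{..<Suc l} = insert 0 (Suc ` {..<l})" by (auto simp: lessThan_Suc_eq_insert_0)
  moreover have "finsum G f (Suc ` {..<l}) = (\<Oplus>q\<in>{..<l}. f (Suc q))"
    by (rule finsum_reindex) (use assms in auto)
  ultimately show ?thesis using assms
    by (simp only:) (subst finsum_insert, auto)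
qed

context cring
begin

definition poly_sum :: "nat \<Rightarrow> (nat \<Rightarrow> 'a) \<Rightarrow> 'a \<Rightarrow> 'a" where
  "poly_sum l c x = (\<Oplus>q\<in>{..<l}. c q \<otimes> x [^] q)"

lemma poly_sum_closed:
  "c \<in> {..<l} \<rightarrow> carrier R \<Longrightarrow> x \<in> carrier R \<Longrightarrow> poly_sum l c x \<in> carrier R"
  unfolding poly_sum_def by (rule finsum_closed) auto

lemma poly_sum_Suc:
  assumes "c \<in> {..<Suc l} \<rightarrow> carrier R" "x \<in> carrier R"
  shows "poly_sum (Suc l) c x = c 0 \<oplus> x \<otimes> poly_sum l (\<lambda>q. c (Suc q)) x"
proof -
  have "poly_sum (Suc l) c x = c 0 \<oplus> (\<Oplus>q\<in>{..<l}. c (Suc q) \<otimes> x [^] Suc q)"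
    unfolding poly_sum_def using assms by (subst finsum_lessThan_Suc_shift) (auto simp: Pi_iff)
  also have "(\<Oplus>q\<in>{..<l}. c (Suc q) \<otimes> x [^] Suc q) = (\<Oplus>q\<in>{..<l}. x \<otimes> (c (Suc q) \<otimes> x [^] q))"
    using assms by (intro finsum_cong') (auto simp: Pi_iff m_ac)
  also have "\<dots> = x \<otimes> poly_sum l (\<lambda>q. c (Suc q)) x"
    unfolding poly_sum_def using assms by (subst finsum_rdistr) (auto simp: Pi_iff)
  finally show ?thesis .
qed

lemma poly_sum_factor:
  assumes "c \<in> {..<Suc l} \<rightarrow> carrier R" "a \<in> carrier R"
  shows "\<exists>d \<in> {..<l} \<rightarrow> carrier R.
    (\<forall>x\<in>carrier R. poly_sum (Suc l) c x = poly_sum (Suc l) c a \<oplus> (x \<ominus> a) \<otimes> poly_sum l d x) \<and>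
    ((\<forall>q<l. d q = \<zero>) \<longrightarrow> (\<forall>q\<in>{1..l}. c q = \<zero>))"
  using assms(1)
proof (induction l arbitrary: c)
  case 0
  then show ?case using assms(2) by (auto simp: poly_sum_Suc) (auto simp: poly_sum_def Pi_iff)
next
  case (Suc l)
  define c' where "c' = (\<lambda>q. c (Suc q))"
  have c': "c' \<in> {..<Suc l} \<rightarrow> carrier R" using Suc.prems by (auto simp: c'_def)
  obtain d where d: "d \<in> {..<l} \<rightarrow> carrier R"
    and d_eq: "\<And>x. x \<in> carrier R \<Longrightarrow>
      poly_sum (Suc l) c' x = poly_sum (Suc l) c' a \<oplus> (x \<ominus> a) \<otimes> poly_sum l d x"
    and d_zero: "(\<forall>q<l. d q = \<zero>) \<longrightarrow> (\<forall>q\<in>{1..l}. c' q = \<zero>)"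
    using Suc.IH[OF c'] by blast
  define P where "P = poly_sum (Suc l) c' a"
  have P: "P \<in> carrier R" unfolding P_def by (rule poly_sum_closed[OF c' assms(2)])
  define d' where "d' = (\<lambda>q. case q of 0 \<Rightarrow> P | Suc i \<Rightarrow> d i)"
  have d': "d' \<in> {..<Suc l} \<rightarrow> carrier R" using d P by (auto simp: d'_def split: nat.splits)
  have c0: "c 0 \<in> carrier R" using Suc.prems by auto
  have eq: "poly_sum (Suc (Suc l)) c x
      = poly_sum (Suc (Suc l)) c a \<oplus> (x \<ominus> a) \<otimes> poly_sum (Suc l) d' x" if x: "x \<in> carrier R" for x
  proof -
    have D: "poly_sum l d x \<in> carrier R" using poly_sum_closed[OF d x] .
    have "poly_sum (Suc (Suc l)) c x = c 0 \<oplus> x \<otimes> (P \<oplus> (x \<ominus> a) \<otimes> poly_sum l d x)"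
      using poly_sum_Suc[OF Suc.prems x] d_eq[OF x] by (simp add: c'_def P_def)
    moreover have "poly_sum (Suc (Suc l)) c a = c 0 \<oplus> a \<otimes> P"
      using poly_sum_Suc[OF Suc.prems assms(2)] by (simp add: c'_def P_def)
    moreover have "poly_sum (Suc l) d' x = P \<oplus> x \<otimes> poly_sum l d x"
      using poly_sum_Suc[OF d' x] by (simp add: d'_def)
    ultimately show ?thesis using x assms(2) P c0 D by simp algebra
  qed
  have zero: "c q = \<zero>" if z: "\<forall>q<Suc l. d' q = \<zero>" and q: "q \<in> {1..Suc l}" for q
  proof -
    have P0: "P = \<zero>" using z by (auto simp: d'_def dest!: spec[of _ 0])
    have d0: "d i = \<zero>" if "i < l" for i using z that by (auto simp: d'_def dest!: spec[of _ "Suc i"])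
    have tail: "c' i = \<zero>" if "i \<in> {1..l}" for i using d_zero d0 that by auto
    have c'0: "c' 0 \<in> carrier R" using c' by auto
    have "poly_sum l (\<lambda>q. c' (Suc q)) a = \<zero>"
      unfolding poly_sum_def using tail assms(2)
      by (subst finsum_cong'[where g = "\<lambda>_. \<zero>" and B = "{..<l}"]) auto
    then have "P = c' 0" unfolding P_def using poly_sum_Suc[OF c' assms(2)] c'0 assms(2) by simp
    then have "c' i = \<zero>" if "i \<le> l" for i using P0 tail[of i] that by (cases i) auto
    then show ?thesis using q by (cases q) (auto simp: c'_def)
  qed
  show ?case using d' eq zero by blast
qed

lemma poly_sum_eq_zero:
  assumes "exceptional R T" "finite J" "\<alpha> \<in> J \<rightarrow> T" "inj_on \<alpha> J"
    and "c \<in> {..<card J} \<rightarrow> carrier R" "\<And>i. i \<in> J \<Longrightarrow> poly_sum (card J) c (\<alpha> i) = \<zero>"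
    and "q < card J"
  shows "c q = \<zero>"
  using assms(2-)
proof (induction "card J" arbitrary: J c q)
  case 0
  then show ?case by simp
next
  case (Suc l)
  then obtain j where j: "j \<in> J" by fastforce
  define J' where "J' = J - {j}"
  have J': "finite J'" "l = card J'" using Suc.hyps(2) Suc.prems(1) j by (auto simp: J'_def)
  have cJ: "card J = Suc l" using Suc.hyps(2) by simp
  have T: "T \<subseteq> carrier R" using assms(1) by (auto simp: exceptional_def)
  have aj: "\<alpha> j \<in> carrier R" using Suc.prems(2) j T by auto
  obtain d where d: "d \<in> {..<l} \<rightarrow> carrier R"
    and d_eq: "\<And>x. x \<in> carrier R \<Longrightarrow>
      poly_sum (Suc l) c x = poly_sum (Suc l) c (\<alpha> j) \<oplus> (x \<ominus> \<alpha> j) \<otimes> poly_sum l d x"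
    and d_zero: "(\<forall>q<l. d q = \<zero>) \<longrightarrow> (\<forall>q\<in>{1..l}. c q = \<zero>)"
    using poly_sum_factor[of c l "\<alpha> j"] Suc.prems(4) aj cJ by auto
  have root: "poly_sum (Suc l) c (\<alpha> i) = \<zero>" if "i \<in> J" for i
    using Suc.prems(5)[OF that] cJ by simp
  have "poly_sum (card J') d (\<alpha> i) = \<zero>" if i: "i \<in> J'" for i
  proof -
    have iJ: "i \<in> J" "i \<noteq> j" using i by (auto simp: J'_def)
    have ai: "\<alpha> i \<in> carrier R" using Suc.prems(2) iJ T by auto
    have "\<alpha> i \<noteq> \<alpha> j" using Suc.prems(3) iJ j by (auto simp: inj_on_def)
    then have U: "\<alpha> i \<ominus> \<alpha> j \<in> Units R"
      using assms(1) Suc.prems(2) iJ j by (auto simp: exceptional_def)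
    have D: "poly_sum l d (\<alpha> i) \<in> carrier R" using poly_sum_closed[OF d ai] .
    have "(\<alpha> i \<ominus> \<alpha> j) \<otimes> poly_sum l d (\<alpha> i) = \<zero>"
      using d_eq[OF ai] root[OF iJ(1)] root[OF j] D ai aj by simp
    then have "(\<alpha> i \<ominus> \<alpha> j) \<otimes> poly_sum l d (\<alpha> i) = (\<alpha> i \<ominus> \<alpha> j) \<otimes> \<zero>"
      using ai aj by simp
    then have "poly_sum l d (\<alpha> i) = \<zero>" using U D Units_l_cancel by blast
    then show ?thesis using J' by simp
  qed
  then have "d q = \<zero>" if "q < l" for q
    using Suc.hyps(1)[OF J'(2) J'(1), of d q] Suc.prems(2,3) d that J'
    by (auto simp: J'_def inj_on_diff)
  then have tail: "c q = \<zero>" if "q \<in> {1..l}" for q using d_zero that by auto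
  have c0: "c 0 \<in> carrier R" using Suc.prems(4) cJ by auto
  have c: "c \<in> {..<Suc l} \<rightarrow> carrier R" using Suc.prems(4) cJ by auto
  have "poly_sum l (\<lambda>q. c (Suc q)) (\<alpha> j) = \<zero>"
    unfolding poly_sum_def using tail aj
    by (subst finsum_cong'[where g = "\<lambda>_. \<zero>" and B = "{..<l}"]) auto
  then have "c 0 = \<zero>" using poly_sum_Suc[OF c aj] root[OF j] c0 aj by simp
  then show ?case using tail Suc.prems(6) cJ by (cases "q = 0") auto
qed

lemma poly_val_poly_sum: "poly_val R c x = poly_sum (dim_vec c) (\<lambda>q. c $ q) x"
  by (simp add: poly_val_def poly_sum_def)

lemma poly_val_unique:
  assumes "exceptional R T" "finite J" "\<alpha> \<in> J \<rightarrow> T" "inj_on \<alpha> J"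
    and c: "c \<in> vecs R (card J)" and c': "c' \<in> vecs R (card J)"
    and eq: "\<And>i. i \<in> J \<Longrightarrow> poly_val R c (\<alpha> i) = poly_val R c' (\<alpha> i)"
  shows "c = c'"
proof -
  define b where "b = (\<lambda>q. c $ q \<ominus> c' $ q)"
  have b: "b \<in> {..<card J} \<rightarrow> carrier R" using vecsD(2)[OF c] vecsD(2)[OF c'] by (auto simp: b_def)
  have root: "poly_sum (card J) b (\<alpha> i) = \<zero>" if i: "i \<in> J" for i
  proof -
    have x: "\<alpha> i \<in> carrier R" using assms(1,3) i by (auto simp: exceptional_def)
    have "c $ q \<otimes> \<alpha> i [^] q = b q \<otimes> \<alpha> i [^] q \<oplus> c' $ q \<otimes> \<alpha> i [^] q" if "q < card J" for q
    proof -
      have "c $ q \<in> carrier R" "c' $ q \<in> carrier R" "\<alpha> i [^] q \<in> carrier R"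
        using vecsD(2)[OF c that] vecsD(2)[OF c' that] x by auto
      then show ?thesis unfolding b_def by algebra
    qed
    then have "poly_val R c (\<alpha> i) = (\<Oplus>q\<in>{..<card J}. b q \<otimes> \<alpha> i [^] q \<oplus> c' $ q \<otimes> \<alpha> i [^] q)"
      unfolding poly_val_def vecsD(1)[OF c] using b vecsD(2)[OF c'] x
      by (intro finsum_cong') (auto simp: Pi_iff)
    also have "\<dots> = poly_sum (card J) b (\<alpha> i) \<oplus> poly_val R c' (\<alpha> i)"
      unfolding poly_val_def poly_sum_def vecsD(1)[OF c'] using b vecsD(2)[OF c'] x
      by (intro finsum_addf) (auto simp: Pi_iff)
    finally have "poly_val R c' (\<alpha> i) = poly_sum (card J) b (\<alpha> i) \<oplus> poly_val R c' (\<alpha> i)"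
      using eq[OF i] by simp
    moreover have "poly_sum (card J) b (\<alpha> i) \<in> carrier R" by (rule poly_sum_closed[OF b x])
    moreover have "poly_val R c' (\<alpha> i) \<in> carrier R"
      unfolding poly_val_poly_sum vecsD(1)[OF c'] using vecsD(2)[OF c'] x
      by (intro poly_sum_closed) auto
    ultimately show ?thesis using add.r_cancel_one' by metis
  qed
  show ?thesis
  proof (rule eq_vecI)
    show "dim_vec c = dim_vec c'" using vecsD(1)[OF c] vecsD(1)[OF c'] by simp
    fix q assume "q < dim_vec c'"
    then have q: "q < card J" using vecsD(1)[OF c'] by simp
    have "b q = \<zero>" by (rule poly_sum_eq_zero[OF assms(1-4) b root q])
    then show "c $ q = c' $ q" using vecsD(2)[OF c q] vecsD(2)[OF c' q] by (simp add: b_def)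
  qed
qed

lemma interpolate_eq:
  assumes "exceptional R T" "finite J" "\<alpha> \<in> J \<rightarrow> T" "inj_on \<alpha> J"
    and c: "c \<in> vecs R (card J)" and y: "\<And>i. i \<in> J \<Longrightarrow> poly_val R c (\<alpha> i) = y i"
  shows "val (interpolate R cm k \<alpha> J y) = c"
proof -
  have "(SOME c. c \<in> vecs R (card J) \<and> (\<forall>i\<in>J. poly_val R c (\<alpha> i) = y i)) = c"
  proof (rule some_equality)
    show "c' = c" if "c' \<in> vecs R (card J) \<and> (\<forall>i\<in>J. poly_val R c' (\<alpha> i) = y i)" for c'
      using poly_val_unique[OF assms(1-4), of c' c] that c y by auto
  qed (use c y in auto)
  then show ?thesis by (simp add: interpolate_def)
qed

end


section \<open>EP codes\<close>

lemma mixed_radix_less: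
  fixes i j a b :: nat
  assumes "i < a" "j < b"
  shows "i * b + j < a * b"
proof -
  have "i * b + j < Suc i * b" using assms(2) by simp
  also have "\<dots> \<le> a * b" using assms(1) by (intro mult_le_mono1) simp
  finally show ?thesis .
qed

context cring
begin

lemma finsum_mult_finsum:
  assumes "finite A" "finite B" "f \<in> A \<rightarrow> carrier R" "g \<in> B \<rightarrow> carrier R"
  shows "(\<Oplus>a\<in>A. f a) \<otimes> (\<Oplus>b\<in>B. g b) = (\<Oplus>x\<in>A \<times> B. f (fst x) \<otimes> g (snd x))"
proof -
  have f: "f a \<in> carrier R" if "a \<in> A" for a using assms(3) that by auto
  have g: "g b \<in> carrier R" if "b \<in> B" for b using assms(4) that by auto
  have "(\<Oplus>a\<in>A. f a) \<otimes> (\<Oplus>b\<in>B. g b) = (\<Oplus>a\<in>A. f a \<otimes> (\<Oplus>b\<in>B. g b))"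
    using assms by (intro finsum_ldistr) auto
  also have "\<dots> = (\<Oplus>a\<in>A. \<Oplus>b\<in>B. f (fst (a, b)) \<otimes> g (snd (a, b)))"
    unfolding fst_conv snd_conv
    by (intro finsum_cong' refl finsum_rdistr) (auto intro!: finsum_closed f g assms(2,4))
  also have "\<dots> = (\<Oplus>x\<in>A \<times> B. f (fst x) \<otimes> g (snd x))"
    using assms(1,2) f g by (intro finsum_cartesian_product) auto
  finally show ?thesis .
qed

lemma poly_val_fibers:
  assumes "finite X" "\<epsilon> \<in> X \<rightarrow> {..<l}" "f \<in> X \<rightarrow> carrier R" "x \<in> carrier R"
  shows "poly_val R (vec l (\<lambda>q. \<Oplus>y\<in>{y\<in>X. \<epsilon> y = q}. f y)) x = (\<Oplus>y\<in>X. f y \<otimes> x [^] \<epsilon> y)"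
proof -
  have "(\<Oplus>y\<in>{y\<in>X. \<epsilon> y = q}. f y) \<otimes> x [^] q = (\<Oplus>y\<in>{y\<in>X. \<epsilon> y = q}. f y \<otimes> x [^] \<epsilon> y)" for q
  proof -
    have "(\<Oplus>y\<in>{y\<in>X. \<epsilon> y = q}. f y) \<otimes> x [^] q = (\<Oplus>y\<in>{y\<in>X. \<epsilon> y = q}. f y \<otimes> x [^] q)"
      using assms by (intro finsum_ldistr) auto
    also have "\<dots> = (\<Oplus>y\<in>{y\<in>X. \<epsilon> y = q}. f y \<otimes> x [^] \<epsilon> y)"
      using assms by (intro finsum_cong') auto
    finally show ?thesis .
  qed
  then have "poly_val R (vec l (\<lambda>q. \<Oplus>y\<in>{y\<in>X. \<epsilon> y = q}. f y)) x
      = (\<Oplus>q\<in>{..<l}. \<Oplus>y\<in>{y\<in>X. \<epsilon> y = q}. f y \<otimes> x [^] \<epsilon> y)"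
    unfolding poly_val_def using assms
    by (intro finsum_cong') (auto simp: Pi_iff intro!: finsum_closed)
  also have "\<dots> = (\<Oplus>y\<in>X. f y \<otimes> x [^] \<epsilon> y)"
    by (rule finsum_fibers) (use assms in auto)
  finally show ?thesis .
qed

lemma eval_blocks_entry:
  assumes "\<And>i j. i < a \<Longrightarrow> j < b \<Longrightarrow> \<epsilon> i j < N"
    and "\<And>i j. i < a \<Longrightarrow> j < b \<Longrightarrow> M i j $$ (p, q) \<in> carrier R"
    and "\<alpha> n \<in> carrier R" "n < N" "p < x" "q < y"
  shows "val (eval_blocks R cm m \<alpha> N a b \<epsilon> x y M) n $$ (p, q)
    = (\<Oplus>z\<in>{..<a} \<times> {..<b}. M (fst z) (snd z) $$ (p, q) \<otimes> \<alpha> n [^] \<epsilon> (fst z) (snd z))"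
proof -
  have fib: "{(i, j). i < a \<and> j < b \<and> \<epsilon> i j = k}
      = {z \<in> {..<a} \<times> {..<b}. \<epsilon> (fst z) (snd z) = k}" for k by auto
  have "coeff_vec R N a b \<epsilon> (\<lambda>i j. M i j $$ (p, q))
      = vec N (\<lambda>k. \<Oplus>z\<in>{z \<in> {..<a} \<times> {..<b}. \<epsilon> (fst z) (snd z) = k}. M (fst z) (snd z) $$ (p, q))"
    unfolding coeff_vec_def fib by (simp only: case_prod_unfold)
  moreover have "poly_val R (vec N (\<lambda>k. \<Oplus>z\<in>{z \<in> {..<a} \<times> {..<b}. \<epsilon> (fst z) (snd z) = k}.
        M (fst z) (snd z) $$ (p, q))) (\<alpha> n)
      = (\<Oplus>z\<in>{..<a} \<times> {..<b}. M (fst z) (snd z) $$ (p, q) \<otimes> \<alpha> n [^] \<epsilon> (fst z) (snd z))"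
    by (rule poly_val_fibers) (use assms in auto)
  ultimately show ?thesis
    using assms(4-6)
    by (simp add: eval_blocks_def bind_costed_def ret_def mat_costed_def multi_eval_def coeff_vec_def)
qed

lemma dim_eval_blocks:
  "dim_row (val (eval_blocks R cm m \<alpha> N a b \<epsilon> x y M) n) = x"
  "dim_col (val (eval_blocks R cm m \<alpha> N a b \<epsilon> x y M) n) = y"
  by (simp_all add: eval_blocks_def bind_costed_def ret_def mat_costed_def)

lemma EP_code_correct:
  assumes exc: "exceptional R T" and \<alpha>: "\<alpha> \<in> {..<N} \<rightarrow> T" and inj: "inj_on \<alpha> {..<N}"
    and dvds: "u dvd t" "w dvd r" "v dvd s" and pos: "t > 0" "r > 0" "s > 0"
    and le: "u * v * w + w - 1 \<le> N"
  shows "computes_with_recovery_threshold N (EP_code R cm m \<alpha> N u v w t r s)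
    (mats R t r \<times> mats R r s) (\<lambda>(A, B). mat_mult R A B) (u * v * w + w - 1)"
  unfolding computes_with_recovery_threshold_def
proof (intro ballI allI impI)
  fix AB J
  assume AB: "AB \<in> mats R t r \<times> mats R r s" and J: "J \<subseteq> {..<N}"
    and card: "card J = u * v * w + w - 1"
  obtain A B where AB_eq: "AB = (A, B)" by (cases AB)
  have A: "A \<in> mats R t r" and B: "B \<in> mats R r s" using AB by (auto simp: AB_eq)
  define a b c where "a = t div u" and "b = r div w" and "c = s div v"
  have t: "t = u * a" and r: "r = w * b" and s: "s = v * c"
    using dvds by (auto simp: a_def b_def c_def)
  have posd: "u > 0" "v > 0" "w > 0" "a > 0" "b > 0" "c > 0"
    using pos by (auto simp: t r s)
  define f where "f = val (eval_blocks R cm m \<alpha> N u w (\<lambda>i j. i * w + j) a b (block a b A))"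
  define g where "g = val (eval_blocks R cm m \<alpha> N w v (\<lambda>k l. (w - 1 - k) + l * (u * w)) b c
    (block b c B))"
  have resp: "response (EP_code R cm m \<alpha> N u v w t r s) AB n = mat_mult R (f n) (g n)" for n
    by (simp add: response_def message_def EP_code_def ep_encode_def bind_costed_def ret_def
        local_mult_def AB_eq f_def g_def a_def b_def c_def case_prod_unfold)
  have Ae: "A $$ (i * a + x, j * b + z) \<in> carrier R" if "i < u" "j < w" "x < a" "z < b" for i j x z
    using matsD(3)[OF A] mixed_radix_less[of i u x a] mixed_radix_less[of j w z b] that
    by (simp add: t r)
  have Be: "B $$ (k * b + z, l * c + y) \<in> carrier R" if "k < w" "l < v" "z < b" "y < c" for k l z y
    using matsD(3)[OF B] mixed_radix_less[of k w z b] mixed_radix_less[of l v y c] that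
    by (simp add: s r)
  have exp_less: "i * w + j + ((w - 1 - k) + l * (u * w)) < u * v * w + w - 1"
    if "i < u" "j < w" "k < w" "l < v" for i j k l
  proof -
    have "(l * u + i) * w + j < v * u * w"
      using mixed_radix_less[OF mixed_radix_less[OF that(4,1)] that(2)] .
    moreover have "i * w + j + l * (u * w) = (l * u + i) * w + j" by (simp add: algebra_simps)
    moreover have "v * u * w = u * v * w" by simp
    ultimately have "i * w + j + l * (u * w) < u * v * w" by linarith
    then show ?thesis using posd by linarith
  qed
  have \<alpha>R: "\<alpha> n \<in> carrier R" if "n < N" for n using exc \<alpha> that by (auto simp: exceptional_def)
  define W where "W = {..<b} \<times> (({..<u} \<times> {..<w}) \<times> ({..<w} \<times> {..<v}))"
  define E where "E = (\<lambda>(z :: nat, (i, j), (k, l)). i * w + j + ((w - 1 - k) + l * (u * w)))"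
  define F where "F = (\<lambda>x y (z, (i, j), (k, l)).
    A $$ (i * a + x, j * b + z) \<otimes> B $$ (k * b + z, l * c + y))"
  define h where "h = (\<lambda>x y. vec (u * v * w + w - 1) (\<lambda>q. \<Oplus>Y\<in>{Y\<in>W. E Y = q}. F x y Y))"
  have finW: "finite W" by (simp add: W_def)
  have E: "E \<in> W \<rightarrow> {..<u * v * w + w - 1}" using exp_less by (auto simp: W_def E_def)
  have F: "F x y \<in> W \<rightarrow> carrier R" if "x < a" "y < c" for x y
    using Ae Be that by (auto simp: W_def F_def)
  have entry: "mat_mult R (f n) (g n) $$ (x, y) = poly_val R (h x y) (\<alpha> n)"
    if n: "n < N" and x: "x < a" and y: "y < c" for n x y
  proof -
    let ?X = "{..<u} \<times> {..<w}" and ?Y = "{..<w} \<times> {..<v}"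
    have fe: "f n $$ (x, z) = (\<Oplus>p\<in>?X. A $$ (fst p * a + x, snd p * b + z) \<otimes> \<alpha> n [^] (fst p * w + snd p))"
      if z: "z < b" for z
    proof -
      have "f n $$ (x, z) = (\<Oplus>p\<in>?X. block a b A (fst p) (snd p) $$ (x, z) \<otimes> \<alpha> n [^] (fst p * w + snd p))"
        unfolding f_def
      proof (rule eval_blocks_entry)
        show "i * w + j < N" if "i < u" "j < w" for i j
          using exp_less[OF that posd(3) posd(2)] le by linarith
      qed (use x z n \<alpha>R Ae in \<open>auto simp: block_def\<close>)
      then show ?thesis using x z by (simp add: block_def)
    qed
    have ge: "g n $$ (z, y) = (\<Oplus>p\<in>?Y. B $$ (fst p * b + z, snd p * c + y)
        \<otimes> \<alpha> n [^] ((w - 1 - fst p) + snd p * (u * w)))" if z: "z < b" for z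
    proof -
      have "g n $$ (z, y) = (\<Oplus>p\<in>?Y. block b c B (fst p) (snd p) $$ (z, y)
          \<otimes> \<alpha> n [^] ((w - 1 - fst p) + snd p * (u * w)))"
        unfolding g_def
      proof (rule eval_blocks_entry)
        show "w - 1 - i + j * (u * w) < N" if "i < w" "j < v" for i j
          using exp_less[OF posd(1) posd(3) that] le by linarith
      qed (use y z n \<alpha>R Be in \<open>auto simp: block_def\<close>)
      then show ?thesis using y z by (simp add: block_def)
    qed
    have "f n $$ (x, z) \<otimes> g n $$ (z, y) = (\<Oplus>Q\<in>?X \<times> ?Y. F x y (z, Q) \<otimes> \<alpha> n [^] E (z, Q))"
      if z: "z < b" for z
    proof -
      have "f n $$ (x, z) \<otimes> g n $$ (z, y) = (\<Oplus>Q\<in>?X \<times> ?Y.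
          (A $$ (fst (fst Q) * a + x, snd (fst Q) * b + z) \<otimes> \<alpha> n [^] (fst (fst Q) * w + snd (fst Q)))
          \<otimes> (B $$ (fst (snd Q) * b + z, snd (snd Q) * c + y)
              \<otimes> \<alpha> n [^] ((w - 1 - fst (snd Q)) + snd (snd Q) * (u * w))))"
        unfolding fe[OF z] ge[OF z]
        by (rule finsum_mult_finsum) (use x y z \<alpha>R[OF n] Ae Be in auto)
      also have "\<dots> = (\<Oplus>Q\<in>?X \<times> ?Y. F x y (z, Q) \<otimes> \<alpha> n [^] E (z, Q))"
      proof (rule finsum_cong'[OF refl])
        show "(\<lambda>Q. F x y (z, Q) \<otimes> \<alpha> n [^] E (z, Q)) \<in> ?X \<times> ?Y \<rightarrow> carrier R"
          using F[OF x y] \<alpha>R[OF n] z by (auto simp: W_def)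
        fix Q assume "Q \<in> ?X \<times> ?Y"
        then obtain i j k l where Q: "Q = ((i, j), (k, l))" and b: "i < u" "j < w" "k < w" "l < v"
          by auto
        show "(A $$ (fst (fst Q) * a + x, snd (fst Q) * b + z) \<otimes> \<alpha> n [^] (fst (fst Q) * w + snd (fst Q)))
          \<otimes> (B $$ (fst (snd Q) * b + z, snd (snd Q) * c + y)
              \<otimes> \<alpha> n [^] ((w - 1 - fst (snd Q)) + snd (snd Q) * (u * w))) = F x y (z, Q) \<otimes> \<alpha> n [^] E (z, Q)"
          unfolding Q using Ae[OF b(1,2) x z] Be[OF b(3,4) z y] \<alpha>R[OF n]
          by (simp add: F_def E_def nat_pow_mult[symmetric] m_ac)
      qed
      finally show ?thesis .
    qed
    then have "mat_mult R (f n) (g n) $$ (x, y)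
        = (\<Oplus>z\<in>{..<b}. \<Oplus>Q\<in>?X \<times> ?Y. F x y (z, Q) \<otimes> \<alpha> n [^] E (z, Q))"
      using x y F[OF x y] \<alpha>R[OF n]
      by (auto simp: mat_mult_def f_def g_def dim_eval_blocks W_def
          intro!: finsum_cong' finsum_closed)
    also have "\<dots> = (\<Oplus>Y\<in>W. F x y Y \<otimes> \<alpha> n [^] E Y)"
      unfolding W_def using F[OF x y] \<alpha>R[OF n]
      by (intro finsum_cartesian_product) (auto simp: W_def)
    also have "\<dots> = poly_val R (h x y) (\<alpha> n)"
      unfolding h_def using poly_val_fibers[OF finW E F[OF x y] \<alpha>R[OF n]] by simp
    finally show ?thesis .
  qed
  have finJ: "finite J" using J finite_subset by blast
  have interp: "val (interpolate R cm m \<alpha> J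
      (\<lambda>i. restrict (response (EP_code R cm m \<alpha> N u v w t r s) AB) J i $$ (x, y))) = h x y"
    if x: "x < a" and y: "y < c" for x y
  proof (rule interpolate_eq[OF exc finJ])
    show "\<alpha> \<in> J \<rightarrow> T" using \<alpha> J by auto
    show "inj_on \<alpha> J" using inj J by (rule inj_on_subset)
    show "h x y \<in> vecs R (card J)"
      unfolding card h_def using F[OF x y] by (intro vecsI) (auto intro!: finsum_closed)
    show "poly_val R (h x y) (\<alpha> i)
        = restrict (response (EP_code R cm m \<alpha> N u v w t r s) AB) J i $$ (x, y)" if "i \<in> J" for i
      using that J entry[OF _ x y, of i] by (auto simp: resp)
  qed
  have dec: "val (decoding (EP_code R cm m \<alpha> N u v w t r s) AB J) = mat t s (\<lambda>(X, Y).
      h (X mod a) (Y mod c) $ (X div a * w + (w - 1) + Y div c * (u * w)))"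
    unfolding decoding_def
    by (rule eq_matI) (use interp posd in \<open>auto simp: EP_code_def ep_decode_def bind_costed_def ret_def
        mat_costed_def a_def[symmetric] c_def[symmetric] Let_def\<close>)
  have "h (X mod a) (Y mod c) $ (X div a * w + (w - 1) + Y div c * (u * w)) = mat_mult R A B $$ (X, Y)"
    if X: "X < t" and Y: "Y < s" for X Y
  proof -
    define x i where "x = X mod a" and "i = X div a"
    define y l where "y = Y mod c" and "l = Y div c"
    have x: "x < a" and y: "y < c" using posd by (auto simp: x_def y_def)
    have i: "i < u" and l: "l < v"
      using X Y posd by (auto simp: i_def l_def t s less_mult_imp_div_less mult.commute)
    have Xeq: "i * a + x = X" and Yeq: "l * c + y = Y" by (simp_all add: x_def i_def y_def l_def)
    let ?e = "i * w + (w - 1) + l * (u * w)"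
    let ?\<beta> = "\<lambda>q. (q mod b, (i, q div b), (q div b, l))"
    have less: "?e < u * v * w + w - 1"
      using exp_less[OF i, of "w - 1" "w - 1" l] l posd by simp
    have qb: "q div b < w" if "q < r" for q
      using that by (simp add: r less_mult_imp_div_less mult.commute)
    have "{Z\<in>W. E Z = ?e} = ?\<beta> ` {..<r}"
    proof (intro Set.set_eqI iffI)
      fix Z assume "Z \<in> {Z\<in>W. E Z = ?e}"
      then obtain z i' j k l' where Z: "Z = (z, (i', j), (k, l'))"
        and b: "z < b" "i' < u" "j < w" "k < w" "l' < v"
        and e: "i' * w + j + ((w - 1 - k) + l' * (u * w)) = ?e"
        by (auto simp: W_def E_def)
      have "(l' * u + i') * w + j = (l * u + i) * w + k" using e b(4) by (simp add: algebra_simps)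
      then have "((l' * u + i') * w + j) div w = ((l * u + i) * w + k) div w"
        and "((l' * u + i') * w + j) mod w = ((l * u + i) * w + k) mod w" by simp_all
      then have jk: "j = k" and q: "l' * u + i' = l * u + i" using b posd by simp_all
      from q have "(l' * u + i') div u = (l * u + i) div u" "(l' * u + i') mod u = (l * u + i) mod u"
        by simp_all
      then have "l' = l" "i' = i" using b(2) i posd by simp_all
      moreover have "j * b + z < r" using mixed_radix_less[OF b(3,1)] by (simp add: r)
      ultimately show "Z \<in> ?\<beta> ` {..<r}" using jk b(1) by (auto simp: Z intro!: image_eqI[of _ _ "j * b + z"])
    next
      fix Z assume "Z \<in> ?\<beta> ` {..<r}"
      then obtain q where q: "q < r" and Z: "Z = ?\<beta> q" by auto
      show "Z \<in> {Z\<in>W. E Z = ?e}" using qb[OF q] posd i l by (auto simp: Z W_def E_def)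
    qed
    moreover have "inj_on ?\<beta> {..<r}" by (rule inj_onI) (metis Pair_inject div_mult_mod_eq)
    moreover have "F x y \<in> ?\<beta> ` {..<r} \<rightarrow> carrier R"
      using F[OF x y] qb posd i l by (auto simp: W_def)
    ultimately have "h x y $ ?e = (\<Oplus>q\<in>{..<r}. F x y (?\<beta> q))"
      using less by (simp add: h_def finsum_reindex)
    also have "\<dots> = (\<Oplus>q\<in>{..<r}. A $$ (X, q) \<otimes> B $$ (q, Y))"
      using X Y matsD(3)[OF A] matsD(3)[OF B]
      by (intro finsum_cong') (auto simp: F_def Xeq Yeq)
    also have "\<dots> = mat_mult R A B $$ (X, Y)"
      using X Y matsD(1,2)[OF A] matsD(1,2)[OF B] by (simp add: mat_mult_def)
    finally show ?thesis by (simp add: x_def y_def i_def l_def)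
  qed
  then show "val (decoding (EP_code R cm m \<alpha> N u v w t r s) AB J) = (case AB of (A, B) \<Rightarrow> mat_mult R A B)"
    unfolding dec unfolding AB_eq prod.case
    by (intro eq_matI) (use matsD(1)[OF A] matsD(2)[OF B] in \<open>auto simp: mat_mult_def\<close>)
qed

end


section \<open>Packing and unpacking\<close>

lemma is_RMFE_cring:
  assumes "is_RMFE p e d' n k S S' \<iota> \<Phi>"
  shows "cring S" "cring S'"
  using assms galois_ring_cring by (auto simp: is_RMFE_def)

lemma RMFE_psi_zero:
  assumes "is_RMFE p e d' n k S S' \<iota> \<Phi>"
  shows "psi \<Phi> \<zero>\<^bsub>S'\<^esub> = vec n (\<lambda>_. \<zero>\<^bsub>S\<^esub>)"
proof -
  interpret S: cring S by (rule is_RMFE_cring(1)[OF assms])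
  interpret S': cring S' by (rule is_RMFE_cring(2)[OF assms])
  let ?z = "psi \<Phi> \<zero>\<^bsub>S'\<^esub>"
  have z: "?z \<in> vecs S n" using assms by (auto simp: is_RMFE_def)
  have "psi \<Phi> (\<zero>\<^bsub>S'\<^esub> \<oplus>\<^bsub>S'\<^esub> \<zero>\<^bsub>S'\<^esub>) = vec_plus S ?z ?z"
    using assms S'.zero_closed unfolding is_RMFE_def by blast
  then have eq: "?z = vec_plus S ?z ?z" by simp
  show ?thesis
  proof (rule eq_vecI)
    fix i assume "i < dim_vec (vec n (\<lambda>_. \<zero>\<^bsub>S\<^esub>))"
    then have i: "i < n" by simp
    have "?z $ i = vec_plus S ?z ?z $ i" using eq by simp
    also have "\<dots> = ?z $ i \<oplus>\<^bsub>S\<^esub> ?z $ i" using vecsD(1)[OF z] i by (simp add: vec_plus_def)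
    finally show "?z $ i = vec n (\<lambda>_. \<zero>\<^bsub>S\<^esub>) $ i"
      using vecsD(2)[OF z i] i S.add.r_cancel_one' by simp
  qed (use vecsD(1)[OF z] in simp)
qed

lemma RMFE_psi_finsum:
  assumes R: "is_RMFE p e d' n k S S' \<iota> \<Phi>" and "finite X" "f \<in> X \<rightarrow> carrier S'"
  shows "psi \<Phi> (finsum S' f X) = vec n (\<lambda>l. \<Oplus>\<^bsub>S\<^esub>x\<in>X. psi \<Phi> (f x) $ l)"
proof -
  interpret S: cring S by (rule is_RMFE_cring(1)[OF R])
  interpret S': cring S' by (rule is_RMFE_cring(2)[OF R])
  have psi: "psi \<Phi> x \<in> vecs S n" if "x \<in> carrier S'" for x using R that by (auto simp: is_RMFE_def)
  have add: "psi \<Phi> (x \<oplus>\<^bsub>S'\<^esub> y) = vec_plus S (psi \<Phi> x) (psi \<Phi> y)"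
    if "x \<in> carrier S'" "y \<in> carrier S'" for x y using R that by (auto simp: is_RMFE_def)
  show ?thesis using assms(2,3)
  proof (induction X rule: finite_induct)
    case empty
    then show ?case by (simp add: RMFE_psi_zero[OF R])
  next
    case (insert x X)
    have f: "f x \<in> carrier S'" "f \<in> X \<rightarrow> carrier S'" using insert.prems by auto
    have "psi \<Phi> (finsum S' f (insert x X)) = vec_plus S (psi \<Phi> (f x)) (psi \<Phi> (finsum S' f X))"
      using insert.hyps f by (simp add: S'.finsum_insert add S'.finsum_closed)
    also have "\<dots> = vec n (\<lambda>l. \<Oplus>\<^bsub>S\<^esub>y\<in>insert x X. psi \<Phi> (f y) $ l)"
    proof (rule eq_vecI)
      fix l assume "l < dim_vec (vec n (\<lambda>l. \<Oplus>\<^bsub>S\<^esub>y\<in>insert x X. psi \<Phi> (f y) $ l))"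
      then have l: "l < n" by simp
      have c: "psi \<Phi> (f y) $ l \<in> carrier S" if "y \<in> insert x X" for y
        using vecsD(2)[OF psi l] insert.prems that by auto
      show "vec_plus S (psi \<Phi> (f x)) (psi \<Phi> (finsum S' f X)) $ l
          = vec n (\<lambda>l. \<Oplus>\<^bsub>S\<^esub>y\<in>insert x X. psi \<Phi> (f y) $ l) $ l"
        using insert.hyps insert.IH[OF f(2)] l c vecsD(1)[OF psi[OF f(1)]]
        by (simp add: vec_plus_def S.finsum_insert Pi_def)
    qed (use vecsD(1)[OF psi[OF f(1)]] in \<open>simp add: vec_plus_def\<close>)
    finally show ?case .
  qed
qed

lemma pack_mats_entry:
  "i < a \<Longrightarrow> j < b \<Longrightarrow>
    val (pack_mats \<Phi> base n a b M) $$ (i, j) = phi \<Phi> (vec n (\<lambda>l. M l $$ (i, j)))"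
  by (simp add: pack_mats_def mat_costed_def)

lemma dim_pack_mats:
  "dim_row (val (pack_mats \<Phi> base n a b M)) = a" "dim_col (val (pack_mats \<Phi> base n a b M)) = b"
  by (simp_all add: pack_mats_def mat_costed_def)

lemma pack_mats_closed:
  assumes R: "is_RMFE p e d' n k S S' \<iota> \<Phi>" and M: "\<And>l. l < n \<Longrightarrow> M l \<in> mats S a b"
  shows "val (pack_mats \<Phi> base n a b M) \<in> mats S' a b"
proof (rule matsI)
  fix i j assume ij: "i < a" "j < b"
  have "vec n (\<lambda>l. M l $$ (i, j)) \<in> vecs S n" using matsD(3)[OF M] ij by (auto intro!: vecsI)
  then show "val (pack_mats \<Phi> base n a b M) $$ (i, j) \<in> carrier S'"
    using R ij by (auto simp: pack_mats_entry is_RMFE_def)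
qed (simp_all add: dim_pack_mats)

lemma unpack_mat_entry:
  assumes "i < a" "j < b"
  shows "val (unpack_mat \<Phi> base a b M) l $$ (i, j) = psi \<Phi> (M $$ (i, j)) $ l"
  using assms by (simp add: unpack_mat_def bind_costed_def ret_def mat_costed_def)

lemma dim_unpack_mat:
  "dim_row (val (unpack_mat \<Phi> base a b M) l) = a" "dim_col (val (unpack_mat \<Phi> base a b M) l) = b"
  by (simp_all add: unpack_mat_def bind_costed_def ret_def mat_costed_def)

lemma unpack_mat_mult_pack:
  assumes R: "is_RMFE p e d' n k S S' \<iota> \<Phi>" and l: "l < n"
    and M: "\<And>l. l < n \<Longrightarrow> M l \<in> mats S a b" and M': "\<And>l. l < n \<Longrightarrow> M' l \<in> mats S b c"
  shows "val (unpack_mat \<Phi> base a c (mat_mult S' (val (pack_mats \<Phi> base' n a b M))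
      (val (pack_mats \<Phi> base'' n b c M')))) l = mat_mult S (M l) (M' l)"
proof (rule eq_matI)
  let ?P = "val (pack_mats \<Phi> base' n a b M)" and ?P' = "val (pack_mats \<Phi> base'' n b c M')"
  interpret S: cring S by (rule is_RMFE_cring(1)[OF R])
  interpret S': cring S' by (rule is_RMFE_cring(2)[OF R])
  fix i j assume "i < dim_row (mat_mult S (M l) (M' l))" "j < dim_col (mat_mult S (M l) (M' l))"
  then have ij: "i < a" "j < c" using matsD[OF M[OF l]] matsD[OF M'[OF l]] by (auto simp: mat_mult_def)
  let ?x = "\<lambda>z. vec n (\<lambda>l. M l $$ (i, z))" and ?y = "\<lambda>z. vec n (\<lambda>l. M' l $$ (z, j))"
  have x: "?x z \<in> vecs S n" and y: "?y z \<in> vecs S n" if "z < b" for z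
    using matsD(3)[OF M] matsD(3)[OF M'] ij that by (auto intro!: vecsI)
  have phi: "phi \<Phi> x \<in> carrier S'" if "x \<in> vecs S n" for x using R that by (auto simp: is_RMFE_def)
  have star: "psi \<Phi> (phi \<Phi> x \<otimes>\<^bsub>S'\<^esub> phi \<Phi> y) = vec_star S x y" if "x \<in> vecs S n" "y \<in> vecs S n" for x y
    using R that by (auto simp: is_RMFE_def)
  have "mat_mult S' ?P ?P' $$ (i, j) = (\<Oplus>\<^bsub>S'\<^esub>z\<in>{..<b}. phi \<Phi> (?x z) \<otimes>\<^bsub>S'\<^esub> phi \<Phi> (?y z))"
    using ij phi x y
    by (simp add: mat_mult_def dim_pack_mats, intro S'.finsum_cong') (auto simp: pack_mats_entry)
  then have "psi \<Phi> (mat_mult S' ?P ?P' $$ (i, j)) $ l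
      = (\<Oplus>\<^bsub>S\<^esub>z\<in>{..<b}. psi \<Phi> (phi \<Phi> (?x z) \<otimes>\<^bsub>S'\<^esub> phi \<Phi> (?y z)) $ l)"
    using l phi x y by (simp add: RMFE_psi_finsum[OF R] Pi_def)
  also have "\<dots> = (\<Oplus>\<^bsub>S\<^esub>z\<in>{..<b}. M l $$ (i, z) \<otimes>\<^bsub>S\<^esub> M' l $$ (z, j))"
    using l ij star[OF x y] matsD(3)[OF M[OF l]] matsD(3)[OF M'[OF l]]
    by (intro S.finsum_cong') (auto simp: vec_star_def)
  also have "\<dots> = mat_mult S (M l) (M' l) $$ (i, j)"
    using ij matsD(1,2)[OF M[OF l]] matsD(1,2)[OF M'[OF l]] by (simp add: mat_mult_def)
  finally show "val (unpack_mat \<Phi> base a c (mat_mult S' ?P ?P')) l $$ (i, j)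
      = mat_mult S (M l) (M' l) $$ (i, j)"
    using ij by (simp add: unpack_mat_entry)
qed (use matsD[OF M[OF l]] matsD[OF M'[OF l]] in \<open>simp_all add: dim_unpack_mat mat_mult_def\<close>)

lemma response_EP_RMFE_II:
  "response (EP_RMFE_II S cm k m \<Phi>1 \<Phi>2 \<alpha> N n u v w t r s) x
    = response (EP_code S cm m \<alpha> N u v w (t div n) r (s div n))
        (val (pack_inputs cm k \<Phi>1 \<Phi>2 n t r s x))"
  by (rule ext) (simp add: response_def message_def EP_RMFE_II_def Let_def bind_costed_def)

lemma decoding_EP_RMFE_II:
  "decoding (EP_RMFE_II S cm k m \<Phi>1 \<Phi>2 \<alpha> N n u v w t r s) x J
    = bind_costed (decoding (EP_code S cm m \<alpha> N u v w (t div n) r (s div n))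
          (val (pack_inputs cm k \<Phi>1 \<Phi>2 n t r s x)) J)
        (unpack_output cm k \<Phi>1 \<Phi>2 n t s)"
  unfolding decoding_def response_EP_RMFE_II by (simp add: EP_RMFE_II_def Let_def)

lemma block_mats:
  assumes "M \<in> mats S (x * a) (y * b)" "i < x" "j < y"
  shows "block a b M i j \<in> mats S a b"
  using matsD(3)[OF assms(1)] assms(2,3) by (auto simp: block_def mixed_radix_less intro!: matsI)

lemma pack_inputs_closed:
  assumes R1: "is_RMFE p e d n k GR GRk \<iota>1 \<Phi>1" and R2: "is_RMFE p e d' n k' GRk GRm \<iota>2 \<Phi>2"
    and dvds: "n dvd t" "n dvd s" and A: "A \<in> mats GR t r" and B: "B \<in> mats GR r s"
  shows "val (pack_inputs cm k'' \<Phi>1 \<Phi>2 n t r s (A, B)) \<in> mats GRm (t div n) r \<times> mats GRm r (s div n)"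
proof -
  have "block (t div n) r A i 0 \<in> mats GR (t div n) r" if "i < n" for i
    by (rule block_mats[where x = n and y = 1]) (use A dvds that in simp_all)
  moreover have "block r (s div n) B 0 j \<in> mats GR r (s div n)" if "j < n" for j
    by (rule block_mats[where x = 1 and y = n]) (use B dvds that in simp_all)
  ultimately show ?thesis
    by (auto simp: pack_inputs_def bind_costed_def ret_def family_costed_def
        intro!: pack_mats_closed[OF R2] pack_mats_closed[OF R1])
qed

lemma unpack_output_mult:
  assumes R1: "is_RMFE p e d n k GR GRk \<iota>1 \<Phi>1" and R2: "is_RMFE p e d' n k' GRk GRm \<iota>2 \<Phi>2"
    and dvds: "n dvd t" "n dvd s" and pos: "t > 0" "s > 0"
    and A: "A \<in> mats GR t r" and B: "B \<in> mats GR r s"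
  shows "val (unpack_output cm k'' \<Phi>1 \<Phi>2 n t s
      (case val (pack_inputs cm k'' \<Phi>1 \<Phi>2 n t r s (A, B)) of (P, Q) \<Rightarrow> mat_mult GRm P Q))
    = mat_mult GR A B"
proof -
  define a c where "a = t div n" and "c = s div n"
  have t: "t = n * a" and s: "s = n * c" using dvds by (auto simp: a_def c_def)
  have posd: "n > 0" "a > 0" "c > 0" using pos by (auto simp: t s)
  interpret GR: cring GR by (rule is_RMFE_cring(1)[OF R1])
  have bA: "block a r A i 0 \<in> mats GR a r" if "i < n" for i
    by (rule block_mats[where x = n and y = 1]) (use A that t in simp_all)
  have bB: "block r c B 0 j \<in> mats GR r c" if "j < n" for j
    by (rule block_mats[where x = 1 and y = n]) (use B that s in simp_all)
  define A1 where "A1 = (\<lambda>i. val (pack_mats \<Phi>1 1 n a r (\<lambda>_. block a r A i 0)))"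
  define B1 where "B1 = val (pack_mats \<Phi>1 1 n r c (\<lambda>j. block r c B 0 j))"
  define C2 where "C2 = mat_mult GRm (val (pack_mats \<Phi>2 (ext_op cm k'') n a r A1))
    (val (pack_mats \<Phi>2 (ext_op cm k'') n r c (\<lambda>_. B1)))"
  have A1: "A1 i \<in> mats GRk a r" if "i < n" for i
    unfolding A1_def by (rule pack_mats_closed[OF R1 bA[OF that]])
  have B1: "B1 \<in> mats GRk r c"
    unfolding B1_def by (rule pack_mats_closed[OF R1 bB])
  have "val (unpack_mat \<Phi>2 (ext_op cm k'') a c C2) i = mat_mult GRk (A1 i) B1" if "i < n" for i
    unfolding C2_def by (rule unpack_mat_mult_pack[OF R2 that]) (use A1 B1 in auto)
  moreover have "val (unpack_mat \<Phi>1 1 a c (mat_mult GRk (A1 i) B1)) j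
      = mat_mult GR (block a r A i 0) (block r c B 0 j)" if "i < n" "j < n" for i j
    unfolding A1_def B1_def by (rule unpack_mat_mult_pack[OF R1 that(2)]) (use bA bB that in auto)
  ultimately have C: "val (unpack_mat \<Phi>1 1 a c (val (unpack_mat \<Phi>2 (ext_op cm k'') a c C2) i)) j
      = mat_mult GR (block a r A i 0) (block r c B 0 j)" if "i < n" "j < n" for i j
    using that by simp
  have "val (unpack_output cm k'' \<Phi>1 \<Phi>2 n t s C2) = mat t s (\<lambda>(x, y).
      val (unpack_mat \<Phi>1 1 a c (val (unpack_mat \<Phi>2 (ext_op cm k'') a c C2) (x div a))) (y div c)
        $$ (x mod a, y mod c))"
    by (simp add: unpack_output_def bind_costed_def ret_def family_costed_def a_def c_def)
  also have "\<dots> = mat_mult GR A B"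
  proof (rule eq_matI)
    fix x y assume "x < dim_row (mat_mult GR A B)" "y < dim_col (mat_mult GR A B)"
    then have x: "x < t" and y: "y < s" using matsD[OF A] matsD[OF B] by (auto simp: mat_mult_def)
    have div_less: "x div a < n" "y div c < n"
      using x y by (auto simp: t s less_mult_imp_div_less mult.commute)
    have "val (unpack_mat \<Phi>1 1 a c (val (unpack_mat \<Phi>2 (ext_op cm k'') a c C2) (x div a))) (y div c)
        $$ (x mod a, y mod c) = (\<Oplus>\<^bsub>GR\<^esub>l\<in>{..<r}. A $$ (x, l) \<otimes>\<^bsub>GR\<^esub> B $$ (l, y))"
      unfolding C[OF div_less] using posd matsD(3)[OF A x] matsD(3)[OF B _ y]
      by (simp add: mat_mult_def block_def, intro GR.finsum_cong') auto
    then show "mat t s (\<lambda>(x, y).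
        val (unpack_mat \<Phi>1 1 a c (val (unpack_mat \<Phi>2 (ext_op cm k'') a c C2) (x div a))) (y div c)
          $$ (x mod a, y mod c)) $$ (x, y) = mat_mult GR A B $$ (x, y)"
      using x y matsD(1,2)[OF A] matsD(1,2)[OF B] by (simp add: mat_mult_def)
  qed (use matsD[OF A] matsD[OF B] in \<open>simp_all add: mat_mult_def\<close>)
  finally show ?thesis
    by (simp add: C2_def A1_def[abs_def] B1_def a_def c_def pack_inputs_def bind_costed_def ret_def family_costed_def)
qed

lemma EP_RMFE_II_correct:
  assumes R1: "is_RMFE p e d n k GR GRk \<iota>1 \<Phi>1" and R2: "is_RMFE p e d' n k' GRk GRm \<iota>2 \<Phi>2"
    and exc: "exceptional GRm T" "\<alpha> \<in> {..<N} \<rightarrow> T" "inj_on \<alpha> {..<N}"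
    and dvds: "n dvd t" "n dvd s" "u dvd t div n" "v dvd s div n" "w dvd r"
    and pos: "t > 0" "r > 0" "s > 0" and le: "u * v * w + w - 1 \<le> N"
  shows "computes_with_recovery_threshold N (EP_RMFE_II GRm cm k'' m \<Phi>1 \<Phi>2 \<alpha> N n u v w t r s)
    (mats GR t r \<times> mats GR r s) (\<lambda>(A, B). mat_mult GR A B) (u * v * w + w - 1)"
  unfolding computes_with_recovery_threshold_def
proof (intro ballI allI impI)
  fix x J assume x: "x \<in> mats GR t r \<times> mats GR r s" and J: "J \<subseteq> {..<N}" "card J = u * v * w + w - 1"
  interpret GRm: cring GRm by (rule is_RMFE_cring(2)[OF R2])
  obtain A B where AB: "x = (A, B)" "A \<in> mats GR t r" "B \<in> mats GR r s" using x by auto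
  have "t div n > 0" "s div n > 0" using pos dvds by (auto simp: dvd_div_eq_0_iff)
  then have "computes_with_recovery_threshold N (EP_code GRm cm m \<alpha> N u v w (t div n) r (s div n))
    (mats GRm (t div n) r \<times> mats GRm r (s div n)) (\<lambda>(A, B). mat_mult GRm A B) (u * v * w + w - 1)"
    using GRm.EP_code_correct[OF exc dvds(3,5,4)] pos(2) le by blast
  then have "val (decoding (EP_code GRm cm m \<alpha> N u v w (t div n) r (s div n))
      (val (pack_inputs cm k'' \<Phi>1 \<Phi>2 n t r s x)) J)
    = (case val (pack_inputs cm k'' \<Phi>1 \<Phi>2 n t r s x) of (P, Q) \<Rightarrow> mat_mult GRm P Q)"
    using pack_inputs_closed[OF R1 R2 dvds(1,2) AB(2,3)] J
    unfolding computes_with_recovery_threshold_def AB(1) by blast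
  then show "val (decoding (EP_RMFE_II GRm cm k'' m \<Phi>1 \<Phi>2 \<alpha> N n u v w t r s) x J)
      = (case x of (A, B) \<Rightarrow> mat_mult GR A B)"
    using unpack_output_mult[OF R1 R2 dvds(1,2) pos(1,3) AB(2,3)]
    by (simp add: decoding_EP_RMFE_II bind_costed_def AB(1))
qed


section \<open>Complexity\<close>

lemma lg_ge_1: "lg x \<ge> 1" and lglg_ge_1: "lglg x \<ge> 1"
  by (simp_all add: lg_def lglg_def)

lemma lg_mono:
  assumes "1 \<le> x" "x \<le> y"
  shows "lg x \<le> lg y"
proof -
  have "ln x \<le> ln y" using assms by simp
  then show ?thesis by (simp add: lg_def max_def)
qed

lemma lglg_mono:
  assumes "1 \<le> x" "x \<le> y"
  shows "lglg x \<le> lglg y"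
proof -
  have "ln (lg x) \<le> ln (lg y)" using lg_mono[OF assms] lg_ge_1[of x] lg_ge_1[of y] by simp
  then show ?thesis by (auto simp: lglg_def max_def)
qed

lemma lglg_le_lg: "lglg x \<le> lg x"
proof -
  have "ln (lg x) \<le> lg x" using lg_ge_1[of x] ln_le_minus_one[of "lg x"] by linarith
  then show ?thesis using lg_ge_1[of x] by (simp add: lglg_def)
qed

lemma quasilin_le:
  assumes "0 \<le> x"
  shows "quasilin x \<le> x * lg x ^ 3"
proof -
  have "x * (lg x)^2 * lglg x \<le> x * (lg x)^2 * lg x"
    using assms lglg_le_lg by (intro mult_left_mono) auto
  then show ?thesis by (simp add: quasilin_def power2_eq_square power3_eq_cube mult.assoc)
qed

lemma extension_degree_bounds:
  fixes p d N m :: nat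
  assumes "prime p" "d \<ge> 1" "N \<ge> 2" "m = nat \<lceil>log (real p) (real N) / real d\<rceil>"
  shows "m \<ge> 1" "real m \<le> 3 * lg (real N)" "lg (real m) \<le> 3 * lglg (real N)"
proof -
  have p: "real p \<ge> 2" using prime_ge_2_nat[OF assms(1)] by simp
  have lnN: "ln (real N) > 0" using assms(3) by simp
  have "ln (real p) \<ge> ln 2" using p by simp
  moreover have "ln 2 \<ge> (1 / 2 :: real)" using ln_le_minus_one[of "1 / 2 :: real"] by (simp add: ln_div)
  ultimately have lnp: "ln (real p) \<ge> 1 / 2" by linarith
  have pos: "log (real p) (real N) > 0" using p assms(3) by simp
  then have "log (real p) (real N) / real d > 0" using assms(2) by simp
  then have "1 \<le> \<lceil>log (real p) (real N) / real d\<rceil>" by linarith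
  from nat_mono[OF this] show m: "m \<ge> 1" unfolding assms(4) by (simp only: nat_1 One_nat_def)
  have "log (real p) (real N) / real d \<le> log (real p) (real N)"
    using pos assms(2) by (simp add: divide_le_eq)
  also have "\<dots> \<le> 2 * ln (real N)"
  proof -
    have "ln (real N) * 1 \<le> ln (real N) * (2 * ln (real p))" using lnN lnp by (intro mult_left_mono) auto
    then show ?thesis using lnp by (simp add: log_def divide_le_eq mult_ac)
  qed
  finally have "log (real p) (real N) / real d \<le> 2 * ln (real N)" .
  then have "real m \<le> 2 * ln (real N) + 1" using assms(4) m by linarith
  moreover have "ln (real N) \<le> lg (real N)" "1 \<le> lg (real N)" by (auto simp: lg_def)
  ultimately show mN: "real m \<le> 3 * lg (real N)" by linarith
  have "ln (real m) \<le> ln (3 * lg (real N))" using mN m by simp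
  also have "\<dots> = ln 3 + ln (lg (real N))" using lg_ge_1[of "real N"] by (simp add: ln_mult)
  also have "\<dots> \<le> 2 + lglg (real N)" using ln_le_minus_one[of 3] by (simp add: lglg_def)
  finally show "lg (real m) \<le> 3 * lglg (real N)"
    using lglg_ge_1[of "real N"] by (simp add: lg_def)
qed

lemma quasilin_le_lglg:
  assumes "1 \<le> x" "x \<le> y" "lg y \<le> 3 * L"
  shows "quasilin x \<le> 27 * x * L ^ 3"
proof -
  have "lg x \<le> 3 * L" using lg_mono[OF assms(1,2)] assms(3) by linarith
  then have "lg x ^ 3 \<le> (3 * L) ^ 3" using lg_ge_1[of x] by (intro power_mono) auto
  then have "x * lg x ^ 3 \<le> x * (3 * L) ^ 3" using assms(1) by (intro mult_left_mono) auto
  also have "x * (3 * L) ^ 3 = 27 * x * L ^ 3" by (simp add: power_mult_distrib)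
  finally show ?thesis using quasilin_le[of x] assms(1) by linarith
qed

lemma cost_pack_mats: "cost (pack_mats \<Phi> base n a b M) = a * b * (phi_ops \<Phi> * base)"
  by (simp add: pack_mats_def mat_costed_def)

lemma cost_unpack_mat: "cost (unpack_mat \<Phi> base a b M) = a * b * (psi_ops \<Phi> * base)"
  by (simp add: unpack_mat_def mat_costed_def bind_costed_def ret_def)

lemma cost_pack_inputs:
  "cost (pack_inputs cm k \<Phi>1 \<Phi>2 n t r s x) =
     n * ((t div n) * r * phi_ops \<Phi>1) + r * (s div n) * phi_ops \<Phi>1
     + (t div n) * r * (phi_ops \<Phi>2 * ext_op cm k) + r * (s div n) * (phi_ops \<Phi>2 * ext_op cm k)"
  by (cases x) (simp add: pack_inputs_def bind_costed_def ret_def family_costed_def cost_pack_mats)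

lemma cost_unpack_output:
  "cost (unpack_output cm k \<Phi>1 \<Phi>2 n t s C) =
     (t div n) * (s div n) * (psi_ops \<Phi>2 * ext_op cm k) + n * ((t div n) * (s div n) * psi_ops \<Phi>1)"
  by (simp add: unpack_output_def bind_costed_def ret_def family_costed_def cost_unpack_mat)

lemma cost_eval_blocks:
  "cost (eval_blocks S cm m \<alpha> N a b \<epsilon> x y M) = x * y * (eval_ops cm m N * ext_op cm m)"
  by (simp add: eval_blocks_def bind_costed_def ret_def mat_costed_def multi_eval_def coeff_vec_def)

lemma cost_ep_encode:
  "cost (ep_encode S cm m \<alpha> N u v w t r s x) =
     ((t div u) * (r div w) + (r div w) * (s div v)) * (eval_ops cm m N * ext_op cm m)"
  by (cases x) (simp add: ep_encode_def bind_costed_def ret_def cost_eval_blocks add_mult_distrib)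

lemma cost_ep_decode:
  "cost (ep_decode S cm m \<alpha> u v w t s J Y) =
     (t div u) * (s div v) * (interp_ops cm m (card J) * ext_op cm m)"
  by (simp add: ep_decode_def bind_costed_def ret_def mat_costed_def interpolate_def)

lemma message_EP_code_dims:
  obtains P Q where "message (EP_code S cm m \<alpha> N u v w t r s) x i = (P, Q)"
    "dim_row P = t div u" "dim_col P = r div w" "dim_row Q = r div w" "dim_col Q = s div v"
  by (cases x) (simp add: message_def EP_code_def ep_encode_def bind_costed_def ret_def
      eval_blocks_def mat_costed_def)

lemma message_EP_RMFE_II:
  "message (EP_RMFE_II S cm k m \<Phi>1 \<Phi>2 \<alpha> N n u v w t r s) x i
    = message (EP_code S cm m \<alpha> N u v w (t div n) r (s div n))
        (val (pack_inputs cm k \<Phi>1 \<Phi>2 n t r s x)) i"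
  by (simp add: message_def EP_RMFE_II_def Let_def bind_costed_def)

lemma upload_EP_RMFE_II:
  "upload N (EP_RMFE_II S cm k m \<Phi>1 \<Phi>2 \<alpha> N' n u v w t r s) x =
     N * (m * ((t div n div u) * (r div w) + (r div w) * (s div n div v)))"
proof -
  let ?D = "EP_RMFE_II S cm k m \<Phi>1 \<Phi>2 \<alpha> N' n u v w t r s"
  have "msg_size ?D (message ?D x i)
      = m * ((t div n div u) * (r div w) + (r div w) * (s div n div v))" for i
  proof -
    obtain P Q where "message ?D x i = (P, Q)"
      "dim_row P = t div n div u" "dim_col P = r div w" "dim_row Q = r div w" "dim_col Q = s div n div v"
      unfolding message_EP_RMFE_II by (rule message_EP_code_dims)
    then show ?thesis by (simp add: EP_RMFE_II_def EP_code_def Let_def mat_size_def add_mult_distrib2)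
  qed
  then show ?thesis by (simp add: upload_def)
qed

lemma response_EP_code_dims:
  "dim_row (response (EP_code S cm m \<alpha> N u v w t r s) x i) = t div u"
  "dim_col (response (EP_code S cm m \<alpha> N u v w t r s) x i) = s div v"
proof -
  obtain P Q where "message (EP_code S cm m \<alpha> N u v w t r s) x i = (P, Q)"
    "dim_row P = t div u" "dim_col P = r div w" "dim_row Q = r div w" "dim_col Q = s div v"
    by (rule message_EP_code_dims)
  then show "dim_row (response (EP_code S cm m \<alpha> N u v w t r s) x i) = t div u"
    "dim_col (response (EP_code S cm m \<alpha> N u v w t r s) x i) = s div v"
    unfolding response_def by (simp_all add: EP_code_def local_mult_def mat_mult_def)
qed

lemma download_EP_RMFE_II:
  "download (EP_RMFE_II S cm k m \<Phi>1 \<Phi>2 \<alpha> N n u v w t r s) x J =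
     card J * (m * ((t div n div u) * (s div n div v)))"
proof -
  have "res_size (EP_RMFE_II S cm k m \<Phi>1 \<Phi>2 \<alpha> N n u v w t r s) = mat_size m"
    by (simp add: EP_RMFE_II_def EP_code_def Let_def)
  then show ?thesis
    by (simp add: download_def response_EP_RMFE_II mat_size_def response_EP_code_dims)
qed

lemma worker_cost_EP_RMFE_II:
  "worker_cost (EP_RMFE_II S cm k m \<Phi>1 \<Phi>2 \<alpha> N n u v w t r s) x i =
     matmul_ops cm m (t div n div u) (r div w) (s div n div v) * ext_op cm m"
proof -
  let ?D = "EP_RMFE_II S cm k m \<Phi>1 \<Phi>2 \<alpha> N n u v w t r s"
  obtain P Q where "message ?D x i = (P, Q)"
    "dim_row P = t div n div u" "dim_col P = r div w" "dim_row Q = r div w" "dim_col Q = s div n div v"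
    unfolding message_EP_RMFE_II by (rule message_EP_code_dims)
  then show ?thesis
    unfolding worker_cost_def by (simp add: EP_RMFE_II_def EP_code_def Let_def local_mult_def)
qed

lemma encoding_cost_EP_RMFE_II:
  "encoding_cost (EP_RMFE_II S cm k m \<Phi>1 \<Phi>2 \<alpha> N n u v w t r s) x =
     n * ((t div n) * r * phi_ops \<Phi>1) + r * (s div n) * phi_ops \<Phi>1
     + (t div n) * r * (phi_ops \<Phi>2 * ext_op cm k) + r * (s div n) * (phi_ops \<Phi>2 * ext_op cm k)
     + ((t div n div u) * (r div w) + (r div w) * (s div n div v)) * (eval_ops cm m N * ext_op cm m)"
  by (simp add: encoding_cost_def EP_RMFE_II_def EP_code_def Let_def bind_costed_def
      cost_pack_inputs cost_ep_encode)

lemma decoding_cost_EP_RMFE_II: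
  "decoding_cost (EP_RMFE_II S cm k m \<Phi>1 \<Phi>2 \<alpha> N n u v w t r s) x J =
     (t div n div u) * (s div n div v) * (interp_ops cm m (card J) * ext_op cm m)
     + (t div n) * (s div n) * (psi_ops \<Phi>2 * ext_op cm k) + n * ((t div n) * (s div n) * psi_ops \<Phi>1)"
  by (simp add: decoding_cost_def decoding_EP_RMFE_II) (simp add: decoding_def EP_code_def bind_costed_def
      cost_unpack_output cost_ep_decode)


lemma encoding_bound:
  fixes a b g u v w n k N phi1 phi2 ek em ev :: nat and K c l L :: real
  assumes uw: "u * w \<le> N" and vw: "v * w \<le> N" and n: "n \<ge> 1"
    and ge: "1 \<le> l" "1 \<le> L" "0 \<le> K" "0 \<le> c" and k: "real k \<le> c * real n"
    and phi1: "real phi1 \<le> 27 * K * real k * L ^ 3" and phi2: "real phi2 \<le> 27 * K * real k * L ^ 3"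
    and ek: "real ek \<le> 27 * K * real k * L ^ 3" and em: "real em \<le> 27 * K * (real k)\<^sup>2 * L ^ 3"
    and ev: "real ev \<le> K * (real N * l\<^sup>2 * L)"
  shows "real (n * (u * a * (w * b) * phi1) + w * b * (v * g) * phi1 + u * a * (w * b) * (phi2 * ek)
      + w * b * (v * g) * (phi2 * ek) + (a * b + b * g) * (ev * em))
    \<le> (27 * K + 729 * K\<^sup>2 * c + 27 * K\<^sup>2 * c)
        * (real n * real (a * b + b * g) * real k * real N * l\<^sup>2 * L ^ 6)"
proof -
  define G where "G = a * b + b * g"
  define Q where "Q = 27 * K * real k * L ^ 3"
  define Y where "Y = real n * real G * real k * real N * l\<^sup>2 * L ^ 6"
  have Q0: "0 \<le> Q" using ge by (simp add: Q_def)
  have l2: "1 \<le> l\<^sup>2" using ge(1) by simp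
  have L36: "L ^ 3 \<le> L ^ 6" and L46: "L ^ 4 \<le> L ^ 6" using ge(2) by (auto intro: power_increasing)
  have kk: "(real k)\<^sup>2 \<le> c * real n * real k"
    using mult_right_mono[OF k, of "real k"] by (simp add: power2_eq_square)
  have S: "u * a * (w * b) + w * b * (v * g) \<le> N * G"
  proof -
    have "u * w * (a * b) + v * w * (b * g) \<le> N * (a * b) + N * (b * g)"
      by (intro add_mono mult_le_mono1 uw vw)
    then show ?thesis by (simp add: G_def algebra_simps)
  qed
  have "w * b * (v * g) * phi1 \<le> n * (w * b * (v * g) * phi1)" using n by simp
  then have "n * (u * a * (w * b) * phi1) + w * b * (v * g) * phi1
      \<le> n * ((u * a * (w * b) + w * b * (v * g)) * phi1)"
    by (simp only: add_mult_distrib add_mult_distrib2 add_left_mono)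
  also have "\<dots> \<le> n * (N * G * phi1)" using S by (intro mult_le_mono2 mult_le_mono1)
  finally have "real (n * (u * a * (w * b) * phi1) + w * b * (v * g) * phi1)
      \<le> real n * (real N * real G * real phi1)" by (simp only: of_nat_mult[symmetric] of_nat_le_iff)
  also have "\<dots> \<le> real n * (real N * real G * Q)"
    using phi1 by (intro mult_left_mono) (auto simp: Q_def)
  also have "\<dots> = 27 * K * real n * real G * real k * real N * 1 * L ^ 3" by (simp add: Q_def)
  also have "\<dots> \<le> 27 * K * real n * real G * real k * real N * l\<^sup>2 * L ^ 6"
    using ge l2 L36 by (intro mult_mono mult_left_mono) auto
  finally have T12: "real (n * (u * a * (w * b) * phi1) + w * b * (v * g) * phi1) \<le> 27 * K * Y"
    by (simp add: Y_def mult_ac)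
  have "u * a * (w * b) * (phi2 * ek) + w * b * (v * g) * (phi2 * ek) \<le> N * G * (phi2 * ek)"
    unfolding add_mult_distrib[symmetric] using S by (intro mult_le_mono1)
  then have "real (u * a * (w * b) * (phi2 * ek) + w * b * (v * g) * (phi2 * ek))
      \<le> real N * real G * (real phi2 * real ek)" by (simp only: of_nat_mult[symmetric] of_nat_le_iff)
  also have "\<dots> \<le> real N * real G * (Q * Q)"
    using phi2 ek Q0 by (intro mult_left_mono mult_mono) (auto simp: Q_def)
  also have "\<dots> = 729 * K\<^sup>2 * real N * real G * 1 * L ^ 6 * (real k)\<^sup>2"
    by (simp add: Q_def power2_eq_square eval_nat_numeral)
  also have "\<dots> \<le> 729 * K\<^sup>2 * real N * real G * l\<^sup>2 * L ^ 6 * (c * real n * real k)"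
    using ge l2 kk by (intro mult_mono) auto
  finally have T34: "real (u * a * (w * b) * (phi2 * ek) + w * b * (v * g) * (phi2 * ek))
      \<le> 729 * K\<^sup>2 * c * Y" by (simp add: Y_def mult_ac)
  have "real (G * (ev * em)) \<le> real G * ((K * (real N * l\<^sup>2 * L)) * (27 * K * (real k)\<^sup>2 * L ^ 3))"
    unfolding of_nat_mult using ev em ge by (intro mult_left_mono mult_mono) auto
  also have "\<dots> = 27 * K\<^sup>2 * real N * real G * l\<^sup>2 * L ^ 4 * (real k)\<^sup>2"
    by (simp add: power2_eq_square eval_nat_numeral)
  also have "\<dots> \<le> 27 * K\<^sup>2 * real N * real G * l\<^sup>2 * L ^ 6 * (c * real n * real k)"
    using ge L46 kk by (intro mult_mono) auto
  finally have T5: "real (G * (ev * em)) \<le> 27 * K\<^sup>2 * c * Y" by (simp add: Y_def mult_ac)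
  show ?thesis
    using T12 T34 T5 unfolding G_def[symmetric] Y_def[symmetric] of_nat_add distrib_right by linarith
qed

lemma decoding_bound:
  fixes a g u v n k R psi1 psi2 ek em ip :: nat and K c l L :: real
  assumes uv: "u * v \<le> R"
    and ge: "1 \<le> l" "1 \<le> L" "0 \<le> K" "0 \<le> c" and k: "real k \<le> c * real n"
    and psi1: "real psi1 \<le> 27 * K * real k * L ^ 3" and psi2: "real psi2 \<le> 27 * K * real k * L ^ 3"
    and ek: "real ek \<le> 27 * K * real k * L ^ 3" and em: "real em \<le> 27 * K * (real k)\<^sup>2 * L ^ 3"
    and ip: "real ip \<le> K * (real R * l\<^sup>2 * L)"
  shows "real (a * g * (ip * em) + u * a * (v * g) * (psi2 * ek) + n * (u * a * (v * g) * psi1))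
    \<le> (27 * K * c + 729 * K\<^sup>2 * c\<^sup>2 + 27 * K\<^sup>2 * c\<^sup>2)
        * ((real n)\<^sup>2 * real (a * g) * real R * l\<^sup>2 * L ^ 6)"
proof -
  define G where "G = a * g"
  define Q where "Q = 27 * K * real k * L ^ 3"
  define Y where "Y = (real n)\<^sup>2 * real G * real R * l\<^sup>2 * L ^ 6"
  have Q0: "0 \<le> Q" using ge by (simp add: Q_def)
  have l2: "1 \<le> l\<^sup>2" using ge(1) by simp
  have L36: "L ^ 3 \<le> L ^ 6" and L46: "L ^ 4 \<le> L ^ 6" using ge(2) by (auto intro: power_increasing)
  have kk: "(real k)\<^sup>2 \<le> c\<^sup>2 * (real n)\<^sup>2"
    using power_mono[OF k, of 2] by (simp add: power_mult_distrib)
  have S: "u * a * (v * g) \<le> R * G"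
    using mult_le_mono1[OF uv, of "a * g"] by (simp add: G_def mult_ac)
  have "real (n * (u * a * (v * g) * psi1)) \<le> real n * (real (R * G) * Q)"
    unfolding of_nat_mult[of n] of_nat_mult[of _ psi1] using S psi1 Q0 unfolding Q_def
    by (intro mult_left_mono mult_mono) (simp_all only: of_nat_le_iff of_nat_0_le_iff)
  also have "\<dots> = 27 * K * real n * real G * real R * 1 * L ^ 3 * real k" by (simp add: Q_def)
  also have "\<dots> \<le> 27 * K * real n * real G * real R * l\<^sup>2 * L ^ 6 * (c * real n)"
    using ge l2 L36 k by (intro mult_mono) auto
  finally have T3: "real (n * (u * a * (v * g) * psi1)) \<le> 27 * K * c * Y"
    by (simp add: Y_def power2_eq_square mult_ac)
  have "real (u * a * (v * g) * (psi2 * ek)) \<le> real (R * G) * (Q * Q)"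
    unfolding of_nat_mult[of _ "psi2 * ek"] of_nat_mult[of psi2] using S psi2 ek Q0 unfolding Q_def
    by (intro mult_mono) (simp_all only: of_nat_le_iff of_nat_0_le_iff mult_nonneg_nonneg)
  also have "\<dots> = 729 * K\<^sup>2 * real R * real G * 1 * L ^ 6 * (real k)\<^sup>2"
    by (simp add: Q_def power2_eq_square eval_nat_numeral)
  also have "\<dots> \<le> 729 * K\<^sup>2 * real R * real G * l\<^sup>2 * L ^ 6 * (c\<^sup>2 * (real n)\<^sup>2)"
    using ge l2 kk by (intro mult_mono) auto
  finally have T2: "real (u * a * (v * g) * (psi2 * ek)) \<le> 729 * K\<^sup>2 * c\<^sup>2 * Y"
    by (simp add: Y_def mult_ac)
  have "real (G * (ip * em)) \<le> real G * ((K * (real R * l\<^sup>2 * L)) * (27 * K * (real k)\<^sup>2 * L ^ 3))"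
    unfolding of_nat_mult using ip em ge by (intro mult_left_mono mult_mono) auto
  also have "\<dots> = 27 * K\<^sup>2 * real R * real G * l\<^sup>2 * L ^ 4 * (real k)\<^sup>2"
    by (simp add: power2_eq_square eval_nat_numeral)
  also have "\<dots> \<le> 27 * K\<^sup>2 * real R * real G * l\<^sup>2 * L ^ 6 * (c\<^sup>2 * (real n)\<^sup>2)"
    using ge L46 kk by (intro mult_mono) auto
  finally have T1: "real (G * (ip * em)) \<le> 27 * K\<^sup>2 * c\<^sup>2 * Y" by (simp add: Y_def mult_ac)
  show ?thesis
    using T1 T2 T3 unfolding G_def[symmetric] Y_def[symmetric] of_nat_add distrib_right by linarith
qed

theorem corollary4p2:
  fixes p e d :: nat and c1 c2 K :: real
  assumes "prime p" "e \<ge> 1" "d \<ge> 1" "0 < c1" "0 < c2" "0 < K"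
  shows "\<exists>(Const :: real) (\<kappa> :: nat). Const > 0 \<and>
    (\<forall>(N :: nat) (m :: nat) (k :: nat) (n :: nat) (t :: nat) (r :: nat) (s :: nat)
       (u :: nat) (v :: nat) (w :: nat) (R :: nat)
       (GR :: gr_elem ring) (GRk :: gr_elem ring) (GRm :: gr_elem ring)
       (\<iota>1 :: gr_elem \<Rightarrow> gr_elem) (\<iota>2 :: gr_elem \<Rightarrow> gr_elem)
       (\<Phi>1 :: (gr_elem, gr_elem) rmfe) (\<Phi>2 :: (gr_elem, gr_elem) rmfe)
       (cm :: op_costs) (T :: gr_elem set) (\<alpha> :: nat \<Rightarrow> gr_elem).
       N \<ge> 2 \<and> m = nat \<lceil>log (real p) (real N) / real d\<rceil> \<and> real k = sqrt (real m) \<and>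
       galois_ring p e d GR \<and> galois_ring p e (d * k) GRk \<and> galois_ring p e (d * m) GRm \<and>
       is_RMFE p e d n k GR GRk \<iota>1 \<Phi>1 \<and> is_RMFE p e (d * k) n k GRk GRm \<iota>2 \<Phi>2 \<and>
       rmfe_cost K k \<Phi>1 \<and> rmfe_cost K k \<Phi>2 \<and> cost_model K cm \<and>
       exceptional GRm T \<and> \<alpha> \<in> {..<N} \<rightarrow> T \<and> inj_on \<alpha> {..<N} \<and>
       t > 0 \<and> r > 0 \<and> s > 0 \<and>
       n dvd t \<and> n dvd s \<and> c1 * sqrt (real m) \<le> real n \<and> real n \<le> c2 * sqrt (real m) \<and>
       u dvd t div n \<and> v dvd s div n \<and> w dvd r \<and> R = u * v * w + w - 1 \<and> R \<le> N \<longrightarrow>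
       (let D = EP_RMFE_II GRm cm k m \<Phi>1 \<Phi>2 \<alpha> N n u v w t r s;
            Inp = mats GR t r \<times> mats GR r s
        in computes_with_recovery_threshold N D Inp (\<lambda>(A, B). mat_mult GR A B) R \<and>
           (\<forall>x\<in>Inp.
             real (upload N D x)
               \<le> Const * (real (t * r * v + s * r * u) / real (u * v * w) * sqrt (real m) * real N) \<and>
             real (encoding_cost D x)
               \<le> Const * (real (t * r * v + s * r * u) / real (u * v * w) * sqrt (real m) * real N
                           * (lg (real N))^2 * (lglg (real N))^\<kappa>) \<and>
             (\<forall>J\<subseteq>{..<N}. card J = R \<longrightarrow>
               real (download D x J)
                 \<le> Const * (real (t * s) / real (u * v) * real R) \<and>
               real (decoding_cost D x J)
                 \<le> Const * (real (t * s) / real (u * v) * real R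
                             * (lg (real R))^2 * (lglg (real N))^\<kappa>)) \<and>
             (\<forall>i<N. real (worker_cost D x i)
                 \<le> Const * (real (t * s * r) / real (u * v * w) * (lglg (real N))^\<kappa>)))))"
proof -
  define c where "c = 1 / c1"
  have c: "0 < c" using assms by (simp add: c_def)
  define C where "C = 1 + c + c\<^sup>2 + 27 * K\<^sup>2 * c\<^sup>2 + (27 * K + 729 * K\<^sup>2 * c + 27 * K\<^sup>2 * c)
    + (27 * K * c + 729 * K\<^sup>2 * c\<^sup>2 + 27 * K\<^sup>2 * c\<^sup>2)"
  have pieces: "0 < c\<^sup>2" "0 < 27 * K\<^sup>2 * c\<^sup>2" "0 < 27 * K + 729 * K\<^sup>2 * c + 27 * K\<^sup>2 * c"
    "0 < 27 * K * c + 729 * K\<^sup>2 * c\<^sup>2 + 27 * K\<^sup>2 * c\<^sup>2"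
    using c assms(6) by (simp_all add: add_pos_pos)
  have C: "0 < C" "c \<le> C" "c\<^sup>2 \<le> C" "27 * K\<^sup>2 * c\<^sup>2 \<le> C"
    "27 * K + 729 * K\<^sup>2 * c + 27 * K\<^sup>2 * c \<le> C" "27 * K * c + 729 * K\<^sup>2 * c\<^sup>2 + 27 * K\<^sup>2 * c\<^sup>2 \<le> C"
    unfolding C_def using c pieces by linarith+
  show ?thesis
  proof (intro exI[of _ C] exI[of _ 6] conjI allI impI C(1), goal_cases)
    case (1 N m k n t r s u v w R GR GRk GRm \<iota>1 \<iota>2 \<Phi>1 \<Phi>2 cm T \<alpha>)
    then have N: "N \<ge> 2" and m_def: "m = nat \<lceil>log (real p) (real N) / real d\<rceil>"
      and km: "real k = sqrt (real m)"
      and R1: "is_RMFE p e d n k GR GRk \<iota>1 \<Phi>1" and R2: "is_RMFE p e (d * k) n k GRk GRm \<iota>2 \<Phi>2"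
      and ops: "rmfe_cost K k \<Phi>1" "rmfe_cost K k \<Phi>2" and cm: "cost_model K cm"
      and exc: "exceptional GRm T" "\<alpha> \<in> {..<N} \<rightarrow> T" "inj_on \<alpha> {..<N}"
      and pos: "t > 0" "r > 0" "s > 0" and dvds: "n dvd t" "n dvd s"
      and nk: "c1 * sqrt (real m) \<le> real n"
      and dvds': "u dvd t div n" "v dvd s div n" "w dvd r" and R_def: "R = u * v * w + w - 1" and RN: "R \<le> N"
      by blast+
    define a b g where "a = t div n div u" and "b = r div w" and "g = s div n div v"
    have tn: "t div n = u * a" and sn: "s div n = v * g" and r: "r = w * b"
      using dvds' by (simp_all add: a_def b_def g_def)
    have t: "t = n * (u * a)" and s: "s = n * (v * g)" 
      using dvd_mult_div_cancel[OF dvds(1)] dvd_mult_div_cancel[OF dvds(2)] tn sn by simp_all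
    have posd: "n > 0" "u > 0" "a > 0" "w > 0" "b > 0" "v > 0" "g > 0"
      using pos by (auto simp: t r s)
    have div_ua: "u * a div u = a" and div_vg: "v * g div v = g" using posd by simp_all
    define L where "L = lglg (real N)"
    have L: "1 \<le> L" unfolding L_def by (rule lglg_ge_1)
    have L36: "L ^ 3 \<le> L ^ 6" using L by (auto intro: power_increasing)
    have m1: "m \<ge> 1" and lgm: "lg (real m) \<le> 3 * L"
      using extension_degree_bounds[OF assms(1,3) N m_def] by (auto simp: L_def)
    have m1': "1 \<le> real m" using m1 by simp
    have mk: "real m = (real k)\<^sup>2" using km by simp
    have "k \<noteq> 0" using mk m1 by (intro notI) simp
    then have k1: "real k \<ge> 1" by simp
    have "real k * 1 \<le> real k * real k" using k1 by (intro mult_left_mono) auto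
    then have k_le_m: "real k \<le> real m" by (simp add: mk power2_eq_square)
    have kc: "real k \<le> c * real n" using nk assms(4) by (simp add: c_def km field_simps)
    have kk: "(real k)\<^sup>2 \<le> c * real n * real k"
      using mult_right_mono[OF kc, of "real k"] by (simp add: power2_eq_square)
    have kkc: "(real k)\<^sup>2 \<le> c\<^sup>2 * (real n)\<^sup>2"
      using power_mono[OF kc, of 2] by (simp add: power_mult_distrib)
    have quasilin_m: "K * quasilin (real m) \<le> 27 * K * (real k)\<^sup>2 * L ^ 3"
      using mult_left_mono[OF quasilin_le_lglg[OF m1' order_refl lgm], of K] assms(6) by (simp add: mk mult_ac)
    have quasilin_k: "K * quasilin (real k) \<le> 27 * K * real k * L ^ 3"
      using mult_left_mono[OF quasilin_le_lglg[OF k1 k_le_m lgm], of K] assms(6) by (simp add: mult_ac)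
    have "1 \<le> k" using k1 by simp
    then have em: "real (ext_op cm m) \<le> 27 * K * (real k)\<^sup>2 * L ^ 3"
      and ek: "real (ext_op cm k) \<le> 27 * K * real k * L ^ 3"
      using cm m1 quasilin_m quasilin_k unfolding cost_model_def by (meson order_trans)+
    have phi: "real (phi_ops \<Phi>1) \<le> 27 * K * real k * L ^ 3" "real (phi_ops \<Phi>2) \<le> 27 * K * real k * L ^ 3"
      and psi: "real (psi_ops \<Phi>1) \<le> 27 * K * real k * L ^ 3" "real (psi_ops \<Phi>2) \<le> 27 * K * real k * L ^ 3"
      using ops quasilin_k unfolding rmfe_cost_def by linarith+
    have R: "u * v * w \<le> R" using posd by (simp add: R_def)
    have uw: "u * w \<le> N" and vw: "v * w \<le> N" and uv: "u * v \<le> R"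
    proof -
      have "u * w \<le> u * v * w" "v * w \<le> u * v * w" "u * v \<le> u * v * w" using posd by simp_all
      then show "u * w \<le> N" "v * w \<le> N" "u * v \<le> R" using R RN by linarith+
    qed
    have R1': "R \<ge> 1" using R posd by (metis One_nat_def Suc_leI le_trans nat_0_less_mult_iff)
    have evN: "real (eval_ops cm m N) \<le> K * (real N * (lg (real N))\<^sup>2 * L)"
      using cm m1 N unfolding cost_model_def quasilin_def L_def by simp
    have ipR: "real (interp_ops cm m R) \<le> K * (real R * (lg (real R))\<^sup>2 * L)"
    proof -
      have "real (interp_ops cm m R) \<le> K * (real R * (lg (real R))\<^sup>2 * lglg (real R))"
        using cm m1 R1' unfolding cost_model_def quasilin_def by simp
      also have "\<dots> \<le> K * (real R * (lg (real R))\<^sup>2 * L)"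
        unfolding L_def using R1' RN assms(6) by (intro mult_left_mono lglg_mono) auto
      finally show ?thesis .
    qed
    have mm: "real (matmul_ops cm m a b g) \<le> K * real (a * b * g)"
      using cm m1 posd unfolding cost_model_def by simp
    have X1: "real (t * r * v + s * r * u) / real (u * v * w) = real n * real (a * b + b * g)"
      using posd by (simp add: t r s field_simps)
    have X2: "real (t * s) / real (u * v) = (real n)\<^sup>2 * real (a * g)"
      using posd by (simp add: t s field_simps power2_eq_square)
    have X3: "real (t * s * r) / real (u * v * w) = (real n)\<^sup>2 * real (a * b * g)"
      using posd by (simp add: t r s field_simps power2_eq_square)
    have up: "real (N * (m * (a * b + b * g))) \<le> C * (real n * real (a * b + b * g) * real k * real N)"
    proof -
      have "real (N * (m * (a * b + b * g))) = real N * real (a * b + b * g) * (real k)\<^sup>2"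
        by (simp add: mk mult_ac)
      also have "\<dots> \<le> real N * real (a * b + b * g) * (c * real n * real k)"
        using kk by (intro mult_left_mono) auto
      also have "\<dots> = c * (real n * real (a * b + b * g) * real k * real N)" by (simp add: mult_ac)
      also have "\<dots> \<le> C * (real n * real (a * b + b * g) * real k * real N)"
        using C(2) by (intro mult_right_mono) auto
      finally show ?thesis .
    qed
    have down: "real (R * (m * (a * g))) \<le> C * ((real n)\<^sup>2 * real (a * g) * real R)"
    proof -
      have "real (R * (m * (a * g))) = real R * real (a * g) * (real k)\<^sup>2" by (simp add: mk mult_ac)
      also have "\<dots> \<le> real R * real (a * g) * (c\<^sup>2 * (real n)\<^sup>2)"
        using kkc by (intro mult_left_mono) auto
      also have "\<dots> = c\<^sup>2 * ((real n)\<^sup>2 * real (a * g) * real R)" by (simp add: mult_ac)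
      also have "\<dots> \<le> C * ((real n)\<^sup>2 * real (a * g) * real R)"
        using C(3) by (intro mult_right_mono) auto
      finally show ?thesis .
    qed
    have work: "real (matmul_ops cm m a b g * ext_op cm m) \<le> C * ((real n)\<^sup>2 * real (a * b * g) * L ^ 6)"
    proof -
      have "real (matmul_ops cm m a b g * ext_op cm m)
          \<le> K * real (a * b * g) * (27 * K * (real k)\<^sup>2 * L ^ 3)"
        unfolding of_nat_mult[of "matmul_ops cm m a b g"] using mm em assms(6)
        by (intro mult_mono) auto
      also have "\<dots> = 27 * K\<^sup>2 * real (a * b * g) * L ^ 3 * (real k)\<^sup>2" by (simp add: power2_eq_square)
      also have "\<dots> \<le> 27 * K\<^sup>2 * real (a * b * g) * L ^ 6 * (c\<^sup>2 * (real n)\<^sup>2)"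
        using L L36 kkc by (intro mult_mono) auto
      also have "\<dots> = 27 * K\<^sup>2 * c\<^sup>2 * ((real n)\<^sup>2 * real (a * b * g) * L ^ 6)" by (simp add: mult_ac)
      also have "\<dots> \<le> C * ((real n)\<^sup>2 * real (a * b * g) * L ^ 6)"
        using C(4) L by (intro mult_right_mono) auto
      finally show ?thesis .
    qed
    note enc = encoding_bound[OF uw vw _ lg_ge_1 L _ _ kc phi ek em evN, of a b g]
    have enc: "real (n * (u * a * (w * b) * phi_ops \<Phi>1) + w * b * (v * g) * phi_ops \<Phi>1
        + u * a * (w * b) * (phi_ops \<Phi>2 * ext_op cm k) + w * b * (v * g) * (phi_ops \<Phi>2 * ext_op cm k)
        + (a * b + b * g) * (eval_ops cm m N * ext_op cm m))
      \<le> C * (real n * real (a * b + b * g) * real k * real N * (lg (real N))\<^sup>2 * L ^ 6)"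
      by (rule order_trans[OF enc mult_right_mono[OF C(5)]]) (use posd assms(6) c L in auto)
    note dec = decoding_bound[OF uv lg_ge_1 L _ _ kc psi ek em ipR, of a g]
    have dec: "real (a * g * (interp_ops cm m R * ext_op cm m)
        + u * a * (v * g) * (psi_ops \<Phi>2 * ext_op cm k) + n * (u * a * (v * g) * psi_ops \<Phi>1))
      \<le> C * ((real n)\<^sup>2 * real (a * g) * real R * (lg (real R))\<^sup>2 * L ^ 6)"
      by (rule order_trans[OF dec mult_right_mono[OF C(6)]]) (use assms(6) c L in auto)
    show ?case
      unfolding Let_def
    proof (intro conjI ballI allI impI)
      show "computes_with_recovery_threshold N (EP_RMFE_II GRm cm k m \<Phi>1 \<Phi>2 \<alpha> N n u v w t r s)
        (mats GR t r \<times> mats GR r s) (\<lambda>(A, B). mat_mult GR A B) R"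
        using EP_RMFE_II_correct[OF R1 R2 exc dvds dvds' pos] RN unfolding R_def .
    qed (use up down work enc dec in \<open>simp_all only: X1 X2 X3 upload_EP_RMFE_II download_EP_RMFE_II
        worker_cost_EP_RMFE_II encoding_cost_EP_RMFE_II decoding_cost_EP_RMFE_II
        tn sn div_ua div_vg b_def[symmetric] r[symmetric] km[symmetric] L_def[symmetric]\<close>)
  qed
qed

end
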